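(* Let $t:\mathbb{N}\to\mathbb{N}$ be any monotone increasing function with $t(n)\le n/2$. Then \[BQC(HAM^{t(n)}_n)\ge\Omega\!\left(\frac{t(n)}{\log t(n)}+\log n\right).\]
   Context: For $x,y\in\{0,1\}^n$, $HAM^t_n(x,y)=1$ iff $\sum_{i=1}^n(x_i\oplus y_i)\neq t$. $\log$ is base 2. Quantum communication model (Yao, no prior entanglement): Alice receives $x$, Bob $y$; each holds private qubits initialized to the input and $|0\rangle$; in each round one player applies a unitary to his qubits and sends one qubit; at the end a qubit is measured giving the output; the cost is the number of qubits exchanged. $BQC(f)$ is the minimum cost of a quantum protocol computing $f$ with error probability at most $1/3$ on every input. *)

theory Defs
  imports Complex_Main "HOL-Library.Landau_Symbols"
begin

definition HAM :: "nat \<Rightarrow> nat \<Rightarrow> bool list \<Rightarrow> bool list \<Rightarrow> bool" where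
  "HAM t n x y = (card {i. i < n \<and> x ! i \<noteq> y ! i} \<noteq> t)"

section \<open>Yao's quantum communication model (no prior entanglement)\<close>

text \<open>A system of N qubits, indexed 0..N-1. A computational basis state is the
set of qubits having value 1 (a subset of {..<N}); a pure state is a complex
amplitude function on basis states.\<close>

type_synonym qstate = "nat set \<Rightarrow> complex"

text \<open>An operator on the qubits of a set S is a matrix indexed by subsets of S.\<close>

type_synonym qop = "nat set \<Rightarrow> nat set \<Rightarrow> complex"

definition unitary_on :: "nat set \<Rightarrow> qop \<Rightarrow> bool" where
  "unitary_on S U \<longleftrightarrow>
     (\<forall>w\<in>Pow S. \<forall>w'\<in>Pow S.
        (\<Sum>v\<in>Pow S. cnj (U v w) * U v w') = (if w = w' then 1 else 0))"

text \<open>Apply U to the qubits in S, tensored with the identity on the others.\<close>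

definition apply_op :: "nat set \<Rightarrow> qop \<Rightarrow> qstate \<Rightarrow> qstate" where
  "apply_op S U \<psi> = (\<lambda>z. \<Sum>w\<in>Pow S. U (z \<inter> S) w * \<psi> ((z - S) \<union> w))"

datatype player = Alice | Bob

fun other :: "player \<Rightarrow> player" where
  "other Alice = Bob"
| "other Bob = Alice"

text \<open>A round: the active player, the unitary applied to all qubits he currently
holds, and the qubit he then sends to the other player.\<close>

type_synonym qround = "player \<times> qop \<times> nat"

definition owned :: "nat \<Rightarrow> (nat \<Rightarrow> player) \<Rightarrow> player \<Rightarrow> nat set" where
  "owned N own p = {i. i < N \<and> own i = p}"

fun valid_rounds :: "nat \<Rightarrow> (nat \<Rightarrow> player) \<Rightarrow> qround list \<Rightarrow> bool" where
  "valid_rounds N own [] = True"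
| "valid_rounds N own ((p, U, q) # rs) =
     (unitary_on (owned N own p) U \<and> q \<in> owned N own p \<and>
      valid_rounds N (own(q := other p)) rs)"

fun run_rounds :: "nat \<Rightarrow> (nat \<Rightarrow> player) \<Rightarrow> qround list \<Rightarrow> qstate \<Rightarrow> qstate" where
  "run_rounds N own [] \<psi> = \<psi>"
| "run_rounds N own ((p, U, q) # rs) \<psi> =
     run_rounds N (own(q := other p)) rs (apply_op (owned N own p) U \<psi>)"

record qprotocol =
  nqubits :: nat
  alice_ws :: "nat set"
  rounds :: "qround list"
  outq :: nat

text \<open>Qubits 0..n-1 hold x (Alice), qubits n..2n-1 hold y (Bob); the remaining
qubits start in |0>, those in alice_ws belong to Alice, the others to Bob.\<close>

definition init_owner :: "nat \<Rightarrow> qprotocol \<Rightarrow> nat \<Rightarrow> player" where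
  "init_owner n P i = (if i < n \<or> i \<in> alice_ws P then Alice else Bob)"

definition init_state :: "nat \<Rightarrow> bool list \<Rightarrow> bool list \<Rightarrow> qstate" where
  "init_state n x y =
     (\<lambda>z. if z = {i. i < n \<and> x ! i} \<union> {n + i | i. i < n \<and> y ! i} then 1 else 0)"

definition well_formed :: "nat \<Rightarrow> qprotocol \<Rightarrow> bool" where
  "well_formed n P \<longleftrightarrow> 2 * n \<le> nqubits P \<and> alice_ws P \<subseteq> {2 * n..<nqubits P} \<and>
     outq P < nqubits P \<and> valid_rounds (nqubits P) (init_owner n P) (rounds P)"

definition final_state :: "nat \<Rightarrow> qprotocol \<Rightarrow> bool list \<Rightarrow> bool list \<Rightarrow> qstate" where
  "final_state n P x y = run_rounds (nqubits P) (init_owner n P) (rounds P) (init_state n x y)"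

definition prob_outcome :: "nat \<Rightarrow> qstate \<Rightarrow> nat \<Rightarrow> bool \<Rightarrow> real" where
  "prob_outcome N \<psi> q b = (\<Sum>z\<in>Pow {..<N}. if (q \<in> z) = b then (cmod (\<psi> z))\<^sup>2 else 0)"

definition computes :: "nat \<Rightarrow> (bool list \<Rightarrow> bool list \<Rightarrow> bool) \<Rightarrow> qprotocol \<Rightarrow> bool" where
  "computes n f P \<longleftrightarrow> well_formed n P \<and>
     (\<forall>x y. length x = n \<longrightarrow> length y = n \<longrightarrow>
        prob_outcome (nqubits P) (final_state n P x y) (outq P) (\<not> f x y) \<le> 1/3)"

text \<open>Cost = number of qubits exchanged = number of rounds.\<close>

definition BQC :: "nat \<Rightarrow> (bool list \<Rightarrow> bool list \<Rightarrow> bool) \<Rightarrow> nat" where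
  "BQC n f = (LEAST c. \<exists>P. computes n f P \<and> length (rounds P) = c)"

end

theory Submission
  imports Defs "HOL-Analysis.Convex"
begin

text \<open>
  The acceptance probability of a protocol with \<open>c\<close> qubits of communication is a sum of \<open>4 ^ c\<close>
  terms \<open>a x * b y\<close> with \<open>a\<close> and \<open>b\<close> bounded by 1 (Yao, Kremer).

  For the term \<open>t / log t\<close>, the problem \<open>HAM\<close> contains, for \<open>m = t div 3\<close> and every \<open>k \<le> m\<close>, the
  question whether two subsets of an \<open>m\<close>-element set meet in exactly \<open>k\<close> points; choose \<open>k\<close> such
  that this happens for at least a \<open>1 / (m + 1)\<close> fraction of all pairs. Composing the acceptance
  probability with the polynomial of a majority vote among \<open>O(log m)\<close> runs brings the error below
  \<open>1 / (2 * (m + 1))\<close> and leaves a sum of \<open>2 ^ O((c + 1) * log m)\<close> product terms. It then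
  correlates noticeably with the Hadamard matrix \<open>(-1) ^ card (X \<inter> Y)\<close>, on which the sign is
  constant where \<open>card (X \<inter> Y) = k\<close>, whereas by Lindsey's lemma every single product term has
  correlation at most \<open>2 ^ (3 * m / 2)\<close>.

  For the term \<open>log n\<close>, fixing \<open>t\<close> differing coordinates turns \<open>HAM\<close> into inequality of strings
  of length at least \<open>n / 2\<close>. The vectors of the values \<open>a x\<close> must then be pairwise separated, and
  a ball of dimension \<open>2 * 4 ^ c\<close> does not contain \<open>2 ^ (n / 2)\<close> separated points unless
  \<open>c = \<Omega>(log n)\<close>.
\<close>

section \<open>Isometries on qubits\<close>

lemma sum_Pow_split:
  fixes f :: "'a set \<Rightarrow> 'b::comm_monoid_add"
  assumes "finite N" "S \<subseteq> N"
  shows "(\<Sum>z\<in>Pow N. f z) = (\<Sum>r\<in>Pow (N - S). \<Sum>w\<in>Pow S. f (r \<union> w))"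
proof -
  have "(\<Sum>r\<in>Pow (N - S). \<Sum>w\<in>Pow S. f (r \<union> w)) = (\<Sum>(r, w)\<in>Pow (N - S) \<times> Pow S. f (r \<union> w))"
    by (simp add: sum.cartesian_product)
  also have "\<dots> = (\<Sum>z\<in>Pow N. f z)"
  proof (rule sum.reindex_bij_witness[of _ "\<lambda>z. (z - S, z \<inter> S)" "\<lambda>(r, w). r \<union> w"])
    fix z assume "z \<in> Pow N"
    moreover have "z - S \<union> z \<inter> S = z" by blast
    ultimately show "(case (z - S, z \<inter> S) of (r, w) \<Rightarrow> r \<union> w) = z" by simp
  next
    fix rw assume "rw \<in> Pow (N - S) \<times> Pow S"
    then show "(case rw of (r, w) \<Rightarrow> r \<union> w) \<in> Pow N"
      and "((case rw of (r, w) \<Rightarrow> r \<union> w) - S, (case rw of (r, w) \<Rightarrow> r \<union> w) \<inter> S) = rw"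
      using assms by auto
  qed (use assms in auto)
  finally show ?thesis ..
qed

lemma sum_Pow_insert:
  fixes f :: "'a set \<Rightarrow> 'b::comm_monoid_add"
  assumes "finite T" "q \<notin> T"
  shows "(\<Sum>w\<in>Pow (insert q T). f w) = (\<Sum>w\<in>Pow T. f w + f (insert q w))"
proof -
  have "inj_on (insert q) (Pow T)"
    using assms(2) by (auto simp: inj_on_def)
  moreover have "Pow T \<inter> insert q ` Pow T = {}"
    using assms(2) by auto
  ultimately show ?thesis
    using assms(1) by (simp add: Pow_insert sum.union_disjoint sum.reindex sum.distrib)
qed

text \<open>Expanding the squared moduli and summing over \<open>v\<close> first produces the inner
  products of the columns of \<open>U\<close>, which \<open>unitary_on\<close> makes
  orthonormal.\<close>

lemma unitary_on_isometry:
  assumes "finite S" "unitary_on S U"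
  shows "(\<Sum>v\<in>Pow S. (cmod (\<Sum>w\<in>Pow S. U v w * \<phi> w))\<^sup>2) = (\<Sum>w\<in>Pow S. (cmod (\<phi> w))\<^sup>2)"
proof -
  have "complex_of_real (\<Sum>v\<in>Pow S. (cmod (\<Sum>w\<in>Pow S. U v w * \<phi> w))\<^sup>2)
      = (\<Sum>v\<in>Pow S. (\<Sum>w\<in>Pow S. \<Sum>w'\<in>Pow S. (cnj (\<phi> w') * \<phi> w) * (cnj (U v w') * U v w)))"
    by (simp only: of_real_sum complex_norm_square cnj_sum complex_cnj_mult sum_product)
       (simp add: mult_ac)
  also have "\<dots> = (\<Sum>w\<in>Pow S. \<Sum>w'\<in>Pow S. (cnj (\<phi> w') * \<phi> w) * (\<Sum>v\<in>Pow S. cnj (U v w') * U v w))"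
    unfolding sum_distrib_left
    by (subst sum.swap) (intro sum.cong refl sum.swap)
  also have "\<dots> = (\<Sum>w\<in>Pow S. \<Sum>w'\<in>Pow S. (cnj (\<phi> w') * \<phi> w) * (if w' = w then 1 else 0))"
    using assms(2) by (intro sum.cong refl) (simp add: unitary_on_def)
  also have "\<dots> = (\<Sum>w\<in>Pow S. cnj (\<phi> w) * \<phi> w)"
    using assms(1) by (intro sum.cong refl) (simp add: if_distrib[where f = "\<lambda>c. _ * c"] sum.delta cong: if_cong)
  also have "\<dots> = complex_of_real (\<Sum>w\<in>Pow S. (cmod (\<phi> w))\<^sup>2)"
    by (simp only: of_real_sum complex_norm_square) (simp add: mult_ac)
  finally show ?thesis
    by (simp only: of_real_eq_iff)
qed

lemma apply_op_isometry:
  assumes "S \<subseteq> {..<N}" "unitary_on S U"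
  shows "(\<Sum>z\<in>Pow {..<N}. (cmod (apply_op S U \<psi> z))\<^sup>2) = (\<Sum>z\<in>Pow {..<N}. (cmod (\<psi> z))\<^sup>2)"
proof -
  have "finite S" using assms(1) finite_subset by blast
  \<comment> \<open>Once the values \<open>r\<close> of the qubits outside \<open>S\<close> are
    fixed, \<open>apply_op\<close> multiplies a vector indexed by \<open>Pow S\<close> by the matrix
    \<open>U\<close>.\<close>
  have "(\<Sum>w\<in>Pow S. (cmod (apply_op S U \<psi> (r \<union> w)))\<^sup>2) = (\<Sum>w\<in>Pow S. (cmod (\<psi> (r \<union> w)))\<^sup>2)"
    if "r \<in> Pow ({..<N} - S)" for r
  proof -
    have "(r \<union> w) \<inter> S = w" "(r \<union> w) - S = r" if "w \<in> Pow S" for w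
      using that \<open>r \<in> _\<close> by auto
    then have "(\<Sum>w\<in>Pow S. (cmod (apply_op S U \<psi> (r \<union> w)))\<^sup>2)
        = (\<Sum>v\<in>Pow S. (cmod (\<Sum>w\<in>Pow S. U v w * \<psi> (r \<union> w)))\<^sup>2)"
      by (intro sum.cong refl) (simp add: apply_op_def)
    also have "\<dots> = (\<Sum>w\<in>Pow S. (cmod (\<psi> (r \<union> w)))\<^sup>2)"
      by (rule unitary_on_isometry[OF \<open>finite S\<close> assms(2)])
    finally show ?thesis .
  qed
  then show ?thesis
    by (simp add: sum_Pow_split[OF finite_lessThan assms(1)])
qed

lemma owned_subset: "owned N own p \<subseteq> {..<N}"
  by (auto simp: owned_def)

lemma run_rounds_isometry:
  assumes "valid_rounds N own rs"
  shows "(\<Sum>z\<in>Pow {..<N}. (cmod (run_rounds N own rs \<psi> z))\<^sup>2) = (\<Sum>z\<in>Pow {..<N}. (cmod (\<psi> z))\<^sup>2)"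
  using assms
proof (induction N own rs \<psi> rule: run_rounds.induct)
  case (2 N own p U q rs \<psi>)
  then show ?case
    by (simp add: apply_op_isometry owned_subset del: fun_upd_apply)
qed simp

text \<open>\<open>computes\<close> only bounds the probability of the wrong outcome; total
  probability 1 turns this into a lower bound for the right one.\<close>

lemma prob_outcome_final_total:
  assumes "well_formed n P"
  shows "prob_outcome (nqubits P) (final_state n P x y) q True
       + prob_outcome (nqubits P) (final_state n P x y) q False = 1"
proof -
  let ?N = "nqubits P" and ?\<psi> = "final_state n P x y"
  have "prob_outcome ?N ?\<psi> q True + prob_outcome ?N ?\<psi> q False
      = (\<Sum>z\<in>Pow {..<?N}. (cmod (?\<psi> z))\<^sup>2)"
    unfolding prob_outcome_def sum.distrib[symmetric] by (intro sum.cong) auto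
  also have "\<dots> = (\<Sum>z\<in>Pow {..<?N}. (cmod (init_state n x y z))\<^sup>2)"
    unfolding final_state_def using assms by (intro run_rounds_isometry) (simp add: well_formed_def)
  also have "\<dots> = (\<Sum>z\<in>Pow {..<?N}. if z = {i. i < n \<and> x ! i} \<union> {n + i | i. i < n \<and> y ! i} then 1 else 0)"
    by (intro sum.cong) (simp_all add: init_state_def)
  also have "\<dots> = 1"
    using assms by (auto simp: well_formed_def)
  finally show ?thesis .
qed

section \<open>Sums of bounded product functions\<close>

text \<open>Matrix rank alone would not do: Lindsey's lemma and the counting of grid cells both need
  factors bounded by 1. Integer coefficients are therefore paid for by repeating terms, so that
  \<open>K\<close> measures total weight.\<close>

inductive rank_one_sum :: "nat \<Rightarrow> ('x \<Rightarrow> 'y \<Rightarrow> complex) \<Rightarrow> bool" where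
  zero: "rank_one_sum 0 (\<lambda>x y. 0)"
| step: "rank_one_sum K F \<Longrightarrow> (\<And>x. cmod (a x) \<le> 1) \<Longrightarrow> (\<And>y. cmod (b y) \<le> 1) \<Longrightarrow>
    rank_one_sum (Suc K) (\<lambda>x y. F x y + a x * b y)"

lemma rank_one_sum_single:
  assumes "\<And>x. cmod (a x) \<le> 1" "\<And>y. cmod (b y) \<le> 1"
  shows "rank_one_sum (Suc 0) (\<lambda>x y. a x * b y)"
  using rank_one_sum.step[OF rank_one_sum.zero assms] by simp

lemma rank_one_sum_add:
  assumes "rank_one_sum K F" "rank_one_sum L G"
  shows "rank_one_sum (K + L) (\<lambda>x y. F x y + G x y)"
  using assms(2)
proof induction
  case zero
  then show ?case using assms(1) by simp
next
  case (step L G a b)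
  then show ?case
    using rank_one_sum.step[of "K + L" "\<lambda>x y. F x y + G x y" a b] by (simp add: add.assoc)
qed

lemma rank_one_sum_sum:
  assumes "finite I" "\<And>i. i \<in> I \<Longrightarrow> rank_one_sum (K i) (F i)"
  shows "rank_one_sum (\<Sum>i\<in>I. K i) (\<lambda>x y. \<Sum>i\<in>I. F i x y)"
  using assms by induction (auto intro: rank_one_sum.zero rank_one_sum_add)

lemma rank_one_sum_mult_single:
  assumes "rank_one_sum L G" and a: "\<And>x. cmod (a x) \<le> 1" and b: "\<And>y. cmod (b y) \<le> 1"
  shows "rank_one_sum L (\<lambda>x y. a x * b y * G x y)"
  using assms(1)
proof induction
  case zero
  then show ?case using rank_one_sum.zero by simp
next
  case (step L G a' b')
  have "cmod (a x * a' x) \<le> 1" "cmod (b y * b' y) \<le> 1" for x y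
    using mult_mono[OF a step.hyps(2)] mult_mono[OF b step.hyps(3)] by (simp_all add: norm_mult)
  then have "rank_one_sum (Suc L) (\<lambda>x y. a x * b y * G x y + (a x * a' x) * (b y * b' y))"
    using step.IH by (intro rank_one_sum.step) auto
  then show ?case by (simp add: algebra_simps)
qed

lemma rank_one_sum_mult:
  assumes "rank_one_sum K F" "rank_one_sum L G"
  shows "rank_one_sum (K * L) (\<lambda>x y. F x y * G x y)"
  using assms(1)
proof induction
  case zero
  then show ?case using rank_one_sum.zero by simp
next
  case (step K F a b)
  then show ?case
    using rank_one_sum_add[OF step.IH rank_one_sum_mult_single[OF assms(2), of a b]]
    by (simp add: algebra_simps)
qed

lemma rank_one_sum_power:
  assumes "rank_one_sum K F"
  shows "rank_one_sum (K ^ d) (\<lambda>x y. F x y ^ d)"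
proof (induction d)
  case 0
  then show ?case using rank_one_sum_single[of "\<lambda>_. 1" "\<lambda>_. 1"] by simp
next
  case (Suc d)
  then show ?case using rank_one_sum_mult[OF assms Suc.IH] by simp
qed

lemma rank_one_sum_of_nat_mult:
  assumes "rank_one_sum K F"
  shows "rank_one_sum (c * K) (\<lambda>x y. of_nat c * F x y)"
  using rank_one_sum_sum[of "{..<c}" "\<lambda>_. K" "\<lambda>_. F"] assms by simp

text \<open>Lets each player encode the input of an embedded problem locally before running a
  protocol; products stay products.\<close>

lemma rank_one_sum_compose:
  assumes "rank_one_sum K F"
  shows "rank_one_sum K (\<lambda>x y. F (u x) (v y))"
  using assms by induction (auto intro: rank_one_sum.intros)

section \<open>Decomposition of protocols\<close>

text \<open>Kremer's normal form: after \<open>c\<close> rounds the state is a sum of \<open>2 ^ c\<close> products of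
  subnormalised vectors. A local unitary acts on one factor of each product; a transmitted qubit
  splits each product into two, according to the value of that qubit.\<close>

definition decomposes ::
  "nat \<Rightarrow> (nat \<Rightarrow> player) \<Rightarrow> nat \<Rightarrow> ((player \<Rightarrow> 'u) \<Rightarrow> qstate) \<Rightarrow> bool" where
  "decomposes N own k \<Psi> \<longleftrightarrow> (\<exists>\<alpha>.
     (\<forall>p i u. (\<Sum>w\<in>Pow (owned N own p). (cmod (\<alpha> p i u w))\<^sup>2) \<le> 1) \<and>
     (\<forall>inp. \<forall>z\<in>Pow {..<N}. \<Psi> inp z =
        (\<Sum>i<k. \<alpha> Alice i (inp Alice) (z \<inter> owned N own Alice)
              * \<alpha> Bob i (inp Bob) (z \<inter> owned N own Bob))))"

lemma other_neq [simp]: "other p \<noteq> p" "p \<noteq> other p"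
  by (cases p; simp)+

lemma neq_player_iff: "r \<noteq> p \<longleftrightarrow> r = other p"
  by (cases p; cases r) auto

lemma prod_players_eq:
  fixes f :: "player \<Rightarrow> 'a::comm_monoid_mult"
  shows "f Alice * f Bob = f p * f (other p)"
  by (cases p) (auto simp: mult.commute)

lemma sum_lessThan_double:
  fixes f :: "nat \<Rightarrow> 'a::comm_monoid_add"
  shows "(\<Sum>i<k + k. f i) = (\<Sum>i<k. f i + f (k + i))"
proof -
  have "{..<k + k} = {..<k} \<union> (+) k ` {..<k}"
    by (auto simp: lessThan_atLeast0 image_add_atLeastLessThan)
  moreover have "{..<k} \<inter> (+) k ` {..<k} = {}" by auto
  ultimately show ?thesis
    by (simp add: sum.union_disjoint sum.reindex sum.distrib)
qed

lemma decomposes_step: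
  assumes dec: "decomposes N own k \<Psi>"
    and U: "unitary_on (owned N own p) U"
    and q: "q \<in> owned N own p"
  shows "decomposes N (own(q := other p)) (k + k) (\<lambda>inp. apply_op (owned N own p) U (\<Psi> inp))"
proof -
  define S where "S = owned N own p"
  define T where "T = owned N own (other p)"
  have S': "owned N (own(q := other p)) p = S - {q}"
    and T': "owned N (own(q := other p)) (other p) = insert q T"
    using q by (auto simp: S_def T_def owned_def)
  have fin: "finite S" "finite T"
    unfolding S_def T_def by (auto intro: finite_subset[OF owned_subset])
  have disj: "S \<inter> T = {}" by (auto simp: S_def T_def owned_def)
  have qS: "q \<in> S" and qT: "q \<notin> T"
    using q disj by (auto simp: S_def)
  obtain \<alpha> where norm: "\<And>p i u. (\<Sum>w\<in>Pow (owned N own p). (cmod (\<alpha> p i u w))\<^sup>2) \<le> 1"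
    and eq: "\<And>inp z. z \<in> Pow {..<N} \<Longrightarrow> \<Psi> inp z =
        (\<Sum>i<k. \<alpha> Alice i (inp Alice) (z \<inter> owned N own Alice)
              * \<alpha> Bob i (inp Bob) (z \<inter> owned N own Bob))"
    using dec unfolding decomposes_def by blast
  have eq': "\<Psi> inp z = (\<Sum>i<k. \<alpha> p i (inp p) (z \<inter> S) * \<alpha> (other p) i (inp (other p)) (z \<inter> T))"
    if "z \<in> Pow {..<N}" for inp z
    unfolding eq[OF that] S_def T_def
    by (intro sum.cong refl prod_players_eq[where f = "\<lambda>p. \<alpha> p _ (inp p) (z \<inter> owned N own p)"])
  define \<beta> where "\<beta> i u w = (\<Sum>v\<in>Pow S. U w v * \<alpha> p i u v)" for i u w
  have \<beta>_norm: "(\<Sum>w\<in>Pow S. (cmod (\<beta> i u w))\<^sup>2) \<le> 1" for i u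
    using unitary_on_isometry[OF fin(1), of U "\<alpha> p i u"] U norm[of p i u] by (simp add: \<beta>_def S_def)
  define \<gamma> where "\<gamma> = \<alpha> (other p)"
  have \<gamma>_norm: "(\<Sum>w\<in>Pow T. (cmod (\<gamma> i u w))\<^sup>2) \<le> 1" for i u
    using norm by (simp add: \<gamma>_def T_def)
  \<comment> \<open>Index \<open>i < k\<close> stands for the value 0 of the sent qubit, index
    \<open>k + i\<close> for the value 1. The sender's factor is restricted to that value of
    \<open>q\<close>, and the receiver's factor vanishes at the other one. So on each basis state
    only one of the two products can contribute.\<close>
  define \<alpha>' where "\<alpha>' r i u w =
    (if r = p then (if i < k then \<beta> i u w else \<beta> (i - k) u (insert q w))
     else if i < k then (if q \<in> w then 0 else \<gamma> i u w)
     else (if q \<in> w then \<gamma> (i - k) u (w - {q}) else 0))" for r i u w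
  have \<beta>_split: "(\<Sum>w\<in>Pow (S - {q}). (cmod (\<beta> i u w))\<^sup>2 + (cmod (\<beta> i u (insert q w)))\<^sup>2) \<le> 1" for i u
    using \<beta>_norm[of i u] sum_Pow_insert[of "S - {q}" q "\<lambda>w. (cmod (\<beta> i u w))\<^sup>2"] fin(1)
      insert_Diff[OF qS] by simp
  have norm_p: "(\<Sum>w\<in>Pow (S - {q}). (cmod (\<alpha>' p i u w))\<^sup>2) \<le> 1" for i u
  proof -
    have "(\<Sum>w\<in>Pow (S - {q}). (cmod (\<alpha>' p i u w))\<^sup>2)
        \<le> (\<Sum>w\<in>Pow (S - {q}). (cmod (\<beta> (if i < k then i else i - k) u w))\<^sup>2
              + (cmod (\<beta> (if i < k then i else i - k) u (insert q w)))\<^sup>2)"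
      by (intro sum_mono) (simp add: \<alpha>'_def)
    also have "\<dots> \<le> 1" by (rule \<beta>_split)
    finally show ?thesis .
  qed
  have norm_o: "(\<Sum>w\<in>Pow (insert q T). (cmod (\<alpha>' (other p) i u w))\<^sup>2) \<le> 1" for i u
  proof -
    have "(\<Sum>w\<in>Pow (insert q T). (cmod (\<alpha>' (other p) i u w))\<^sup>2)
        = (\<Sum>w\<in>Pow T. (cmod (\<gamma> (if i < k then i else i - k) u w))\<^sup>2)"
      unfolding sum_Pow_insert[OF fin(2) qT]
    proof (intro sum.cong refl)
      fix w assume "w \<in> Pow T"
      then have "q \<notin> w" using qT by blast
      then show "(cmod (\<alpha>' (other p) i u w))\<^sup>2 + (cmod (\<alpha>' (other p) i u (insert q w)))\<^sup>2
          = (cmod (\<gamma> (if i < k then i else i - k) u w))\<^sup>2"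
        by (simp add: \<alpha>'_def)
    qed
    also have "\<dots> \<le> 1" by (rule \<gamma>_norm)
    finally show ?thesis .
  qed
  have "(\<Sum>w\<in>Pow (owned N (own(q := other p)) r). (cmod (\<alpha>' r i u w))\<^sup>2) \<le> 1" for r i u
    using norm_p[of i u] norm_o[of i u] S' T' by (cases "r = p") (auto simp: neq_player_iff)
  moreover have "apply_op S U (\<Psi> inp) z =
        (\<Sum>i<k + k. \<alpha>' Alice i (inp Alice) (z \<inter> owned N (own(q := other p)) Alice)
              * \<alpha>' Bob i (inp Bob) (z \<inter> owned N (own(q := other p)) Bob))"
    if z: "z \<in> Pow {..<N}" for inp z
  proof -
    have "apply_op S U (\<Psi> inp) z = (\<Sum>w\<in>Pow S. U (z \<inter> S) w *
        (\<Sum>i<k. \<alpha> p i (inp p) w * \<gamma> i (inp (other p)) (z \<inter> T)))"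
      unfolding apply_op_def
    proof (intro sum.cong refl)
      fix w assume w: "w \<in> Pow S"
      then have "(z - S \<union> w) \<inter> S = w" "(z - S \<union> w) \<inter> T = z \<inter> T"
        using disj by auto
      moreover have "z - S \<union> w \<in> Pow {..<N}"
        using w z owned_subset[of N own p] by (auto simp: S_def)
      ultimately show "U (z \<inter> S) w * \<Psi> inp (z - S \<union> w) = U (z \<inter> S) w *
        (\<Sum>i<k. \<alpha> p i (inp p) w * \<gamma> i (inp (other p)) (z \<inter> T))"
        by (simp add: eq' \<gamma>_def)
    qed
    also have "\<dots> = (\<Sum>i<k. \<beta> i (inp p) (z \<inter> S) * \<gamma> i (inp (other p)) (z \<inter> T))"
      unfolding \<beta>_def sum_distrib_left sum_distrib_right
      by (subst sum.swap) (simp add: mult_ac)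
    also have "\<dots> = (\<Sum>i<k. \<alpha>' p i (inp p) (z \<inter> (S - {q})) * \<alpha>' (other p) i (inp (other p)) (z \<inter> insert q T)
        + \<alpha>' p (k + i) (inp p) (z \<inter> (S - {q})) * \<alpha>' (other p) (k + i) (inp (other p)) (z \<inter> insert q T))"
    proof (intro sum.cong refl, cases "q \<in> z")
      case True
      then have "insert q (z \<inter> (S - {q})) = z \<inter> S" "z \<inter> insert q T - {q} = z \<inter> T"
        using qS qT by auto
      then show "\<beta> i (inp p) (z \<inter> S) * \<gamma> i (inp (other p)) (z \<inter> T) =
          \<alpha>' p i (inp p) (z \<inter> (S - {q})) * \<alpha>' (other p) i (inp (other p)) (z \<inter> insert q T)
        + \<alpha>' p (k + i) (inp p) (z \<inter> (S - {q})) * \<alpha>' (other p) (k + i) (inp (other p)) (z \<inter> insert q T)"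
        if "i \<in> {..<k}" for i
        using True that unfolding \<alpha>'_def by simp
    next
      case False
      then have "z \<inter> (S - {q}) = z \<inter> S" "z \<inter> insert q T = z \<inter> T"
        by auto
      then show "\<beta> i (inp p) (z \<inter> S) * \<gamma> i (inp (other p)) (z \<inter> T) =
          \<alpha>' p i (inp p) (z \<inter> (S - {q})) * \<alpha>' (other p) i (inp (other p)) (z \<inter> insert q T)
        + \<alpha>' p (k + i) (inp p) (z \<inter> (S - {q})) * \<alpha>' (other p) (k + i) (inp (other p)) (z \<inter> insert q T)"
        if "i \<in> {..<k}" for i
        using False that unfolding \<alpha>'_def by simp
    qed
    also have "\<dots> = (\<Sum>i<k + k. \<alpha>' p i (inp p) (z \<inter> (S - {q}))
        * \<alpha>' (other p) i (inp (other p)) (z \<inter> insert q T))"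
      by (rule sum_lessThan_double[symmetric])
    also have "\<dots> = (\<Sum>i<k + k. \<alpha>' Alice i (inp Alice) (z \<inter> owned N (own(q := other p)) Alice)
              * \<alpha>' Bob i (inp Bob) (z \<inter> owned N (own(q := other p)) Bob))"
      unfolding S'[symmetric] T'[symmetric]
      by (intro sum.cong refl prod_players_eq[symmetric,
            where f = "\<lambda>r. \<alpha>' r _ (inp r) (z \<inter> owned N (own(q := other p)) r)"])
    finally show ?thesis .
  qed
  ultimately show ?thesis
    unfolding decomposes_def S_def[symmetric] by blast
qed

lemma decomposes_run_rounds:
  assumes "decomposes N own k \<Psi>" "valid_rounds N own rs"
  shows "\<exists>own'. decomposes N own' (2 ^ length rs * k) (\<lambda>inp. run_rounds N own rs (\<Psi> inp))"
  using assms
proof (induction rs arbitrary: own k \<Psi>)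
  case Nil
  then show ?case by auto
next
  case (Cons r rs)
  obtain p U q where r: "r = (p, U, q)" by (cases r)
  then have "decomposes N (own(q := other p)) (k + k) (\<lambda>inp. apply_op (owned N own p) U (\<Psi> inp))"
    using Cons.prems by (intro decomposes_step) auto
  from Cons.IH[OF this] Cons.prems(2) show ?case
    by (simp add: r mult_2[symmetric] mult_ac del: fun_upd_apply)
qed

lemma decomposes_init_state:
  assumes "2 * n \<le> nqubits P" "alice_ws P \<subseteq> {2 * n..<nqubits P}"
  shows "decomposes (nqubits P) (init_owner n P) 1 (\<lambda>inp. init_state n (inp Alice) (inp Bob))"
proof -
  let ?N = "nqubits P" and ?own = "init_owner n P"
  define E where "E p x = (case p of Alice \<Rightarrow> {i. i < n \<and> x ! i} | Bob \<Rightarrow> {n + i | i. i < n \<and> x ! i})"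
    for p and x :: "bool list"
  define \<alpha> where "\<alpha> p (i::nat) x w = (if w = E p x then 1 else 0 :: complex)" for p i x w
  have fin: "finite (owned ?N ?own p)" for p by (rule finite_subset[OF owned_subset]) simp
  have E: "E p x \<subseteq> owned ?N ?own p" for p x
    using assms by (cases p) (auto simp: E_def owned_def init_owner_def)
  have "(\<Sum>w\<in>Pow (owned ?N ?own p). (cmod (\<alpha> p i x w))\<^sup>2)
      = (\<Sum>w\<in>Pow (owned ?N ?own p). if w = E p x then 1 else 0)" for p i x
    by (intro sum.cong) (auto simp: \<alpha>_def)
  then have "(\<Sum>w\<in>Pow (owned ?N ?own p). (cmod (\<alpha> p i x w))\<^sup>2) \<le> 1" for p i x
    using E fin by simp
  moreover have "init_state n (inp Alice) (inp Bob) z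
      = (\<Sum>i<1. \<alpha> Alice i (inp Alice) (z \<inter> owned ?N ?own Alice) * \<alpha> Bob i (inp Bob) (z \<inter> owned ?N ?own Bob))"
    if "z \<in> Pow {..<?N}" for inp z
  proof -
    let ?A = "owned ?N ?own Alice" and ?B = "owned ?N ?own Bob"
    have "z \<subseteq> ?A \<union> ?B" "?A \<inter> ?B = {}"
      using that by (auto simp: owned_def neq_player_iff)
    then have "z = E Alice (inp Alice) \<union> E Bob (inp Bob)
        \<longleftrightarrow> z \<inter> ?A = E Alice (inp Alice) \<and> z \<inter> ?B = E Bob (inp Bob)"
      using E[of Alice "inp Alice"] E[of Bob "inp Bob"] by blast
    moreover have "init_state n (inp Alice) (inp Bob) z
        = (if z = E Alice (inp Alice) \<union> E Bob (inp Bob) then 1 else 0)"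
      by (simp add: init_state_def E_def)
    ultimately show ?thesis
      by (simp add: \<alpha>_def)
  qed
  ultimately show ?thesis unfolding decomposes_def by blast
qed

text \<open>The squared modulus of a sum of \<open>k\<close> products is a sum over
  \<open>k * k\<close> pairs \<open>i\<close>, \<open>j\<close>. Summed over the basis states that
  show outcome \<open>b\<close>, each pair factors into partial inner products \<open>G\<close>, one
  for each player. These are at most 1 by the inequality between the arithmetic and geometric mean,
  since the vectors are subnormalised.\<close>

lemma decomposes_prob_outcome:
  assumes "decomposes N own k \<Psi>" "q < N"
  shows "rank_one_sum (k * k) (\<lambda>x y. complex_of_real
           (prob_outcome N (\<Psi> (case_player x y)) q b))"
proof -
  let ?A = "owned N own Alice" and ?B = "owned N own Bob"
  obtain \<alpha> where norm: "\<And>p i u. (\<Sum>w\<in>Pow (owned N own p). (cmod (\<alpha> p i u w))\<^sup>2) \<le> 1"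
    and eq: "\<And>inp z. z \<in> Pow {..<N} \<Longrightarrow> \<Psi> inp z =
        (\<Sum>i<k. \<alpha> Alice i (inp Alice) (z \<inter> ?A) * \<alpha> Bob i (inp Bob) (z \<inter> ?B))"
    using assms(1) unfolding decomposes_def by blast
  \<comment> \<open>Qubit \<open>q\<close> lies with exactly one player, so the outcome restricts
    only that player's part of the basis state; this is what makes the restricted sum
    factor.\<close>
  define ok where "ok p w \<longleftrightarrow> (if own q = p then (q \<in> w) = b else True)" for p w
  define G where "G p i j u = (\<Sum>w\<in>Pow (owned N own p).
      if ok p w then \<alpha> p i u w * cnj (\<alpha> p j u w) else 0)" for p i j u
  have G_le: "cmod (G p i j u) \<le> 1" for p i j u
  proof -
    have "cmod (G p i j u) \<le> (\<Sum>w\<in>Pow (owned N own p). ((cmod (\<alpha> p i u w))\<^sup>2 + (cmod (\<alpha> p j u w))\<^sup>2) / 2)"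
      unfolding G_def
    proof (rule order_trans[OF norm_sum], rule sum_mono)
      fix w
      have "cmod (\<alpha> p i u w) * cmod (\<alpha> p j u w) \<le> ((cmod (\<alpha> p i u w))\<^sup>2 + (cmod (\<alpha> p j u w))\<^sup>2) / 2"
        using sum_squares_bound[of "cmod (\<alpha> p i u w)" "cmod (\<alpha> p j u w)"] by simp
      then show "cmod (if ok p w then \<alpha> p i u w * cnj (\<alpha> p j u w) else 0)
          \<le> ((cmod (\<alpha> p i u w))\<^sup>2 + (cmod (\<alpha> p j u w))\<^sup>2) / 2"
        by (simp add: norm_mult)
    qed
    also have "\<dots> = ((\<Sum>w\<in>Pow (owned N own p). (cmod (\<alpha> p i u w))\<^sup>2)
        + (\<Sum>w\<in>Pow (owned N own p). (cmod (\<alpha> p j u w))\<^sup>2)) / 2"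
      by (simp only: sum.distrib sum_divide_distrib[symmetric])
    also have "\<dots> \<le> 1" using norm[of p i u] norm[of p j u] by simp
    finally show ?thesis .
  qed
  have "{..<N} - ?B = ?A"
    by (auto simp: owned_def neq_player_iff)
  have disj: "?A \<inter> ?B = {}" by (auto simp: owned_def)
  have main: "complex_of_real (prob_outcome N (\<Psi> (case_player x y)) q b)
      = (\<Sum>i<k. \<Sum>j<k. G Alice i j x * G Bob i j y)" for x y
  proof -
    have "complex_of_real (prob_outcome N (\<Psi> (case_player x y)) q b)
       = (\<Sum>u\<in>Pow ?A. \<Sum>v\<in>Pow ?B. complex_of_real (if (q \<in> u \<union> v) = b
            then (cmod (\<Psi> (case_player x y) (u \<union> v)))\<^sup>2 else 0))"
      unfolding prob_outcome_def sum_Pow_split[OF finite_lessThan owned_subset[of N own Bob]] of_real_sum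
      by (simp only: \<open>{..<N} - ?B = ?A\<close>)
    also have "\<dots> = (\<Sum>u\<in>Pow ?A. \<Sum>v\<in>Pow ?B. \<Sum>i<k. \<Sum>j<k.
        (if ok Alice u then \<alpha> Alice i x u * cnj (\<alpha> Alice j x u) else 0) *
        (if ok Bob v then \<alpha> Bob i y v * cnj (\<alpha> Bob j y v) else 0))"
    proof (intro sum.cong refl)
      fix u v assume u: "u \<in> Pow ?A" and v: "v \<in> Pow ?B"
      have *: "(u \<union> v) \<inter> ?A = u" "(u \<union> v) \<inter> ?B = v" using u v disj by auto
      have "u \<union> v \<in> Pow {..<N}" using u v by (auto simp: owned_def)
      then have \<Psi>: "\<Psi> (case_player x y) (u \<union> v) = (\<Sum>i<k. \<alpha> Alice i x u * \<alpha> Bob i y v)"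
        by (simp add: eq *)
      have "(q \<in> u \<union> v) = b \<longleftrightarrow> ok Alice u \<and> ok Bob v"
        using u v \<open>q < N\<close> by (cases "own q") (auto simp: ok_def owned_def)
      then show "complex_of_real (if (q \<in> u \<union> v) = b
            then (cmod (\<Psi> (case_player x y) (u \<union> v)))\<^sup>2 else 0) = (\<Sum>i<k. \<Sum>j<k.
        (if ok Alice u then \<alpha> Alice i x u * cnj (\<alpha> Alice j x u) else 0) *
        (if ok Bob v then \<alpha> Bob i y v * cnj (\<alpha> Bob j y v) else 0))"
        unfolding \<Psi>
        by (cases "ok Alice u"; cases "ok Bob v")
           (simp_all add: complex_norm_square sum_product mult_ac del: of_real_power)
    qed
    also have "\<dots> = (\<Sum>i<k. \<Sum>j<k. \<Sum>u\<in>Pow ?A. \<Sum>v\<in>Pow ?B.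
        (if ok Alice u then \<alpha> Alice i x u * cnj (\<alpha> Alice j x u) else 0) *
        (if ok Bob v then \<alpha> Bob i y v * cnj (\<alpha> Bob j y v) else 0))"
      by (simp only: sum.swap[of _ "Pow ?B" "{..<k}"] sum.swap[of _ "Pow ?A" "{..<k}"])
    also have "\<dots> = (\<Sum>i<k. \<Sum>j<k. G Alice i j x * G Bob i j y)"
      by (simp add: G_def sum_product)
    finally show ?thesis .
  qed
  have "rank_one_sum (\<Sum>i<k. \<Sum>j<k. Suc 0) (\<lambda>x y. \<Sum>i<k. \<Sum>j<k. G Alice i j x * G Bob i j y)"
    by (intro rank_one_sum_sum rank_one_sum_single G_le) auto
  then show ?thesis
    using main by simp
qed

lemma rank_one_sum_prob_outcome:
  assumes "well_formed n P"
  shows "rank_one_sum (4 ^ length (rounds P)) (\<lambda>x y. complex_of_real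
           (prob_outcome (nqubits P) (final_state n P x y) (outq P) b))"
proof -
  let ?N = "nqubits P" and ?c = "length (rounds P)"
  obtain own' where "decomposes ?N own' (2 ^ ?c * 1)
      (\<lambda>inp. run_rounds ?N (init_owner n P) (rounds P) (init_state n (inp Alice) (inp Bob)))"
    using decomposes_run_rounds[OF decomposes_init_state] assms unfolding well_formed_def by blast
  from decomposes_prob_outcome[OF this, of "outq P" b] assms show ?thesis
    by (simp add: well_formed_def final_state_def power_mult_distrib[symmetric])
qed

section \<open>Correlation with the Hadamard matrix\<close>

lemma cmod_parallelogram: "(cmod (u + v))\<^sup>2 + (cmod (u - v))\<^sup>2 = 2 * ((cmod u)\<^sup>2 + (cmod v)\<^sup>2)"
  unfolding cmod_power2 by (simp add: power2_eq_square algebra_simps)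

text \<open>By induction on \<open>S\<close>: a new element \<open>e\<close> changes the sign only
  if it lies in both sets. The transform thus splits into the sum and the difference of two
  transforms over the smaller set, and the parallelogram law doubles the total.\<close>

lemma hadamard_parseval:
  assumes "finite S"
  shows "(\<Sum>X\<in>Pow S. (cmod (\<Sum>Y\<in>Pow S. (-1) ^ card (X \<inter> Y) * b Y))\<^sup>2)
    = 2 ^ card S * (\<Sum>Y\<in>Pow S. (cmod (b Y))\<^sup>2)"
  using assms
proof (induction S arbitrary: b rule: finite_induct)
  case empty
  then show ?case by simp
next
  case (insert e S)
  define F where "F b X = (\<Sum>Y\<in>Pow S. (-1) ^ card (X \<inter> Y) * b Y)" for b :: "'a set \<Rightarrow> complex" and X
  let ?b' = "\<lambda>Y. b (insert e Y)"
  have in0: "(\<Sum>Y\<in>Pow (insert e S). (-1) ^ card (X \<inter> Y) * b Y) = F b X + F ?b' X" (is "?l = _")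
    and in1: "(\<Sum>Y\<in>Pow (insert e S). (-1) ^ card (insert e X \<inter> Y) * b Y) = F b X - F ?b' X" (is "?r = _")
    if X: "X \<in> Pow S" for X
  proof -
    have eX: "e \<notin> X" and "finite X"
      using X insert.hyps by (auto intro: finite_subset)
    then have "insert e X \<inter> Y = X \<inter> Y" "card (insert e X \<inter> insert e Y) = Suc (card (X \<inter> Y))"
      if "Y \<in> Pow S" for Y
      using that insert.hyps by auto
    then show "?r = F b X - F ?b' X"
      unfolding F_def sum_Pow_insert[OF insert.hyps(1,2)] sum_subtractf[symmetric]
      by (intro sum.cong refl) simp
    show "?l = F b X + F ?b' X"
      unfolding F_def sum_Pow_insert[OF insert.hyps(1,2)] sum.distrib[symmetric]
      using eX by (intro sum.cong refl) simp
  qed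
  have "(\<Sum>X\<in>Pow (insert e S). (cmod (\<Sum>Y\<in>Pow (insert e S). (-1) ^ card (X \<inter> Y) * b Y))\<^sup>2)
      = (\<Sum>X\<in>Pow S. (cmod (F b X + F ?b' X))\<^sup>2 + (cmod (F b X - F ?b' X))\<^sup>2)"
    unfolding sum_Pow_insert[OF insert.hyps(1,2), of "\<lambda>X. (cmod (\<Sum>Y\<in>Pow (insert e S). (-1) ^ card (X \<inter> Y) * b Y))\<^sup>2"]
    by (intro sum.cong refl) (simp add: in0 in1)
  also have "\<dots> = 2 * ((\<Sum>X\<in>Pow S. (cmod (F b X))\<^sup>2) + (\<Sum>X\<in>Pow S. (cmod (F ?b' X))\<^sup>2))"
    unfolding cmod_parallelogram sum.distrib[symmetric] sum_distrib_left ..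
  also have "\<dots> = 2 ^ card (insert e S) * (\<Sum>Y\<in>Pow (insert e S). (cmod (b Y))\<^sup>2)"
    using insert by (simp add: F_def sum_Pow_insert sum.distrib algebra_simps)
  finally show ?case .
qed

text \<open>The bound on \<open>a\<close> reduces the sum to the absolute values of the transform of
  \<open>b\<close>. Cauchy-Schwarz, Parseval and the bound on \<open>b\<close> each contribute a
  factor \<open>2 ^ card S\<close> to its square.\<close>

lemma lindsey:
  assumes "finite S" and a: "\<And>X. cmod (a X) \<le> 1" and b: "\<And>Y. cmod (b Y) \<le> 1"
  shows "cmod (\<Sum>X\<in>Pow S. \<Sum>Y\<in>Pow S. (-1) ^ card (X \<inter> Y) * (a X * b Y)) \<le> sqrt (8 ^ card S)"
proof -
  define T where "T X = (\<Sum>Y\<in>Pow S. (-1) ^ card (X \<inter> Y) * b Y)" for X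
  have le: "cmod (\<Sum>X\<in>Pow S. \<Sum>Y\<in>Pow S. (-1) ^ card (X \<inter> Y) * (a X * b Y)) \<le> (\<Sum>X\<in>Pow S. cmod (T X))"
  proof (rule order_trans[OF norm_sum], rule sum_mono)
    fix X
    have "(\<Sum>Y\<in>Pow S. (-1) ^ card (X \<inter> Y) * (a X * b Y)) = a X * T X"
      unfolding T_def sum_distrib_left by (simp add: mult_ac)
    then show "cmod (\<Sum>Y\<in>Pow S. (-1) ^ card (X \<inter> Y) * (a X * b Y)) \<le> cmod (T X)"
      using mult_right_mono[OF a, of "cmod (T X)"] by (simp add: norm_mult)
  qed
  have "(\<Sum>X\<in>Pow S. cmod (T X))\<^sup>2 \<le> card (Pow S) * (\<Sum>X\<in>Pow S. (cmod (T X))\<^sup>2)"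
    using sum_squared_le_sum_of_squares[of "\<lambda>X. cmod (T X)" "Pow S"] assms(1) by (simp add: mult.commute)
  also have "\<dots> = 2 ^ card S * (2 ^ card S * (\<Sum>Y\<in>Pow S. (cmod (b Y))\<^sup>2))"
    using assms(1) by (simp add: T_def hadamard_parseval card_Pow)
  also have "\<dots> \<le> 2 ^ card S * (2 ^ card S * (\<Sum>Y\<in>Pow S. 1))"
    using b by (intro mult_left_mono sum_mono power_le_one) auto
  also have "\<dots> = 8 ^ card S"
    using assms(1) by (simp add: card_Pow flip: power_mult_distrib)
  finally show ?thesis
    using le real_le_rsqrt order_trans by blast
qed

lemma rank_one_sum_hadamard_correlation:
  assumes "rank_one_sum K F" "finite S"
  shows "cmod (\<Sum>X\<in>Pow S. \<Sum>Y\<in>Pow S. (-1) ^ card (X \<inter> Y) * F X Y) \<le> real K * sqrt (8 ^ card S)"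
  using assms(1)
proof induction
  case zero
  then show ?case by simp
next
  case (step K F a b)
  have "(\<Sum>X\<in>Pow S. \<Sum>Y\<in>Pow S. (-1) ^ card (X \<inter> Y) * (F X Y + a X * b Y))
      = (\<Sum>X\<in>Pow S. \<Sum>Y\<in>Pow S. (-1) ^ card (X \<inter> Y) * F X Y)
        + (\<Sum>X\<in>Pow S. \<Sum>Y\<in>Pow S. (-1) ^ card (X \<inter> Y) * (a X * b Y))"
    by (simp only: distrib_left sum.distrib)
  also have "cmod \<dots> \<le> real K * sqrt (8 ^ card S) + sqrt (8 ^ card S)"
    by (intro norm_triangle_mono step.IH lindsey assms(2) step.hyps)
  finally show ?case by (simp add: algebra_simps)
qed

text \<open>Pigeonhole: \<open>4 ^ card S\<close> pairs share \<open>card S + 1\<close> possible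
  intersection sizes.\<close>

lemma popular_intersection_size:
  assumes "finite S"
  shows "\<exists>k\<le>card S. 4 ^ card S \<le> (card S + 1) * card {(X, Y) \<in> Pow S \<times> Pow S. card (X \<inter> Y) = k}"
proof (rule ccontr)
  let ?N = "\<lambda>k. {(X, Y) \<in> Pow S \<times> Pow S. card (X \<inter> Y) = k}"
  assume "\<not> ?thesis"
  then have less: "(card S + 1) * card (?N k) < 4 ^ card S" if "k \<le> card S" for k
    using that by (meson not_le)
  have "Pow S \<times> Pow S \<subseteq> (\<Union>k\<in>{..card S}. ?N k)"
    using assms by (auto intro!: card_mono)
  then have "card (Pow S \<times> Pow S) \<le> card (\<Union>k\<in>{..card S}. ?N k)"
    using assms by (intro card_mono) (auto intro: finite_subset[of _ "Pow S \<times> Pow S"])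
  also have "\<dots> \<le> (\<Sum>k\<le>card S. card (?N k))"
    by (rule card_UN_le) simp
  finally have "(card S + 1) * 4 ^ card S \<le> (\<Sum>k\<le>card S. (card S + 1) * card (?N k))"
    using assms unfolding sum_distrib_left[symmetric]
    by (intro mult_le_mono) (simp_all add: card_cartesian_product card_Pow flip: power_mult_distrib)
  also have "\<dots> < (\<Sum>k\<le>card S. 4 ^ card S)"
    by (rule sum_strict_mono) (simp, simp, rule less, simp)
  finally show False by simp
qed

text \<open>On the pairs counted by the indicator the sign is always \<open>(-1) ^ k\<close>, so
  nothing cancels and the indicator correlates with the full number of these pairs. Replacing it by
  \<open>G\<close> costs at most \<open>\<epsilon>\<close> for each pair.\<close>

lemma intersection_correlation_ge:
  fixes G :: "'a set \<Rightarrow> 'a set \<Rightarrow> complex"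
  assumes "finite S"
    and approx: "\<And>X Y. X \<subseteq> S \<Longrightarrow> Y \<subseteq> S \<Longrightarrow> cmod (G X Y - of_bool (card (X \<inter> Y) = k)) \<le> \<epsilon>"
  shows "real (card {(X, Y) \<in> Pow S \<times> Pow S. card (X \<inter> Y) = k}) - \<epsilon> * 4 ^ card S
    \<le> cmod (\<Sum>X\<in>Pow S. \<Sum>Y\<in>Pow S. (-1) ^ card (X \<inter> Y) * G X Y)"
proof -
  let ?Q = "Pow S \<times> Pow S"
  let ?s = "\<lambda>(X, Y). (-1) ^ card (X \<inter> Y) :: complex"
  let ?i = "\<lambda>(X, Y). of_bool (card (X \<inter> Y) = k) :: complex"
  have fin: "finite ?Q" using assms(1) by simp
  have "(\<Sum>z\<in>?Q. ?s z * ?i z) = (\<Sum>z\<in>?Q. (-1) ^ k * ?i z)"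
    by (intro sum.cong) auto
  also have "\<dots> = (-1) ^ k * of_nat (card {(X, Y) \<in> ?Q. card (X \<inter> Y) = k})"
    unfolding sum_distrib_left[symmetric] using fin
    by (simp add: case_prod_unfold sum_of_bool_eq Int_def[of "Pow S \<times> Pow S"] mem_Times_iff conj_assoc)
  finally have main: "cmod (\<Sum>z\<in>?Q. ?s z * ?i z) = real (card {(X, Y) \<in> ?Q. card (X \<inter> Y) = k})"
    by (simp add: norm_mult norm_power)
  have "cmod (\<Sum>z\<in>?Q. ?s z * (case_prod G z - ?i z)) \<le> (\<Sum>z\<in>?Q. \<epsilon>)"
    using approx by (intro order_trans[OF norm_sum] sum_mono) (auto simp: norm_mult norm_power)
  also have "\<dots> = \<epsilon> * 4 ^ card S"
    using assms(1) by (simp add: card_cartesian_product card_Pow flip: power_mult_distrib)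
  finally have err: "cmod (\<Sum>z\<in>?Q. ?s z * (case_prod G z - ?i z)) \<le> \<epsilon> * 4 ^ card S" .
  have "(\<Sum>X\<in>Pow S. \<Sum>Y\<in>Pow S. (-1) ^ card (X \<inter> Y) * G X Y) = (\<Sum>z\<in>?Q. ?s z * case_prod G z)"
    by (simp add: sum.cartesian_product case_prod_unfold)
  also have "\<dots> = (\<Sum>z\<in>?Q. ?s z * ?i z) + (\<Sum>z\<in>?Q. ?s z * (case_prod G z - ?i z))"
    by (simp add: sum.distrib[symmetric] algebra_simps)
  finally have eq: "(\<Sum>X\<in>Pow S. \<Sum>Y\<in>Pow S. (-1) ^ card (X \<inter> Y) * G X Y)
      = (\<Sum>z\<in>?Q. ?s z * ?i z) + (\<Sum>z\<in>?Q. ?s z * (case_prod G z - ?i z))" .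
  show ?thesis
    unfolding eq using main err norm_diff_ineq[of "\<Sum>z\<in>?Q. ?s z * ?i z" "\<Sum>z\<in>?Q. ?s z * (case_prod G z - ?i z)"]
    by linarith
qed

section \<open>Error reduction by majority\<close>

text \<open>For \<open>p + q = 1\<close> this is the probability of at least \<open>e\<close>
  successes in \<open>2 * e\<close> independent trials. Keeping \<open>q\<close> as a separate
  variable leaves only natural coefficients, so the number of product terms stays under control; the
  general type covers both real probabilities and their complex copies.\<close>

definition majority_poly :: "nat \<Rightarrow> 'a::comm_semiring_1 \<Rightarrow> 'a \<Rightarrow> 'a" where
  "majority_poly e p q = (\<Sum>j = e..2 * e. of_nat (2 * e choose j) * (p ^ j * q ^ (2 * e - j)))"

text \<open>For \<open>j \<ge> e\<close>, trading the surplus factors \<open>p\<close> for the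
  larger \<open>q\<close> bounds each term by \<open>(p * q) ^ e\<close>, and
  \<open>p * q \<le> 2/9\<close>. The binomial coefficients sum to \<open>4 ^ e\<close>. The index
  set \<open>J\<close> is left open because the two error bounds below use tails with and without
  the tie \<open>j = e\<close>.\<close>

lemma binomial_tail_bound:
  fixes p q :: real
  assumes "0 \<le> p" "p \<le> 1/3" "p + q = 1" "J \<subseteq> {e..2 * e}"
  shows "(\<Sum>j\<in>J. of_nat (2 * e choose j) * (p ^ j * q ^ (2 * e - j))) \<le> (8/9) ^ e"
proof -
  have pq: "p \<le> q" "0 \<le> q" using assms(1-3) by linarith+
  have q: "q = 1 - p" using assms(3) by simp
  have "2/9 - p * q = (1/3 - p) * (2/3 - p)"
    unfolding q by (simp add: field_simps)
  also have "\<dots> \<ge> 0" using assms(2) by simp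
  finally have pq_le: "p * q \<le> 2/9" by simp
  have term_le: "p ^ j * q ^ (2 * e - j) \<le> (2/9) ^ e" if j: "j \<in> {e..2 * e}" for j
  proof -
    have "p ^ j * q ^ (2 * e - j) = p ^ e * p ^ (j - e) * q ^ (2 * e - j)"
      using j by (simp flip: power_add)
    also have "\<dots> \<le> p ^ e * q ^ (j - e) * q ^ (2 * e - j)"
      using pq assms(1) by (intro mult_right_mono mult_left_mono power_mono) auto
    also have "\<dots> = (p * q) ^ e"
      using j by (simp add: power_mult_distrib flip: power_add)
    also have "\<dots> \<le> (2/9) ^ e"
      using pq_le pq assms(1) by (intro power_mono) auto
    finally show ?thesis .
  qed
  have "(\<Sum>j\<in>J. of_nat (2 * e choose j) * (p ^ j * q ^ (2 * e - j)))
      \<le> (\<Sum>j\<in>J. of_nat (2 * e choose j) * (2/9) ^ e)"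
    using assms(4) term_le by (intro sum_mono mult_left_mono) auto
  also have "\<dots> \<le> (\<Sum>j\<le>2 * e. of_nat (2 * e choose j) * (2/9) ^ e)"
    using assms(4) by (intro sum_mono2) auto
  also have "\<dots> = 2 ^ (2 * e) * (2/9) ^ e"
    using choose_row_sum[of "2 * e"] by (simp flip: sum_distrib_right of_nat_sum)
  also have "\<dots> = (8/9) ^ e"
    by (simp add: power_mult flip: power_mult_distrib)
  finally show ?thesis .
qed

lemma majority_poly_small:
  fixes p q :: real
  assumes "0 \<le> p" "p \<le> 1/3" "p + q = 1"
  shows "\<bar>majority_poly e p q\<bar> \<le> (8/9) ^ e"
proof -
  have "0 \<le> majority_poly e p q"
    unfolding majority_poly_def using assms by (intro sum_nonneg) auto
  then show ?thesis
    using binomial_tail_bound[OF assms order_refl] by (simp add: majority_poly_def)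
qed

text \<open>The complementary event is the lower tail; the reflection of \<open>j\<close> to
  \<open>2 * e - j\<close> makes it a strict upper tail with \<open>p\<close> and \<open>q\<close>
  exchanged.\<close>

lemma majority_poly_large:
  fixes p q :: real
  assumes "0 \<le> q" "q \<le> 1/3" "p + q = 1"
  shows "\<bar>majority_poly e p q - 1\<bar> \<le> (8/9) ^ e"
proof -
  let ?f = "\<lambda>j. of_nat (2 * e choose j) * (p ^ j * q ^ (2 * e - j))"
  let ?g = "\<lambda>j. of_nat (2 * e choose j) * (q ^ j * p ^ (2 * e - j))"
  have "1 = (p + q) ^ (2 * e)" using assms by simp
  also have "\<dots> = (\<Sum>j\<le>2 * e. ?f j)"
    by (simp add: binomial_ring mult.assoc)
  also have "{..2 * e} = {..<e} \<union> {e..2 * e}" by auto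
  also have "(\<Sum>j\<in>\<dots>. ?f j) = (\<Sum>j<e. ?f j) + majority_poly e p q"
    unfolding majority_poly_def by (rule sum.union_disjoint) auto
  also have "(\<Sum>j<e. ?f j) = (\<Sum>j\<in>{e<..2 * e}. ?g j)"
  proof (rule sum.reindex_bij_witness[of _ "\<lambda>j. 2 * e - j" "\<lambda>j. 2 * e - j"])
    fix j assume "j \<in> {..<e}"
    then show "?g (2 * e - j) = ?f j"
      using binomial_symmetric[of j "2 * e"] by (simp add: mult.commute)
  qed auto
  finally have "1 - majority_poly e p q = (\<Sum>j\<in>{e<..2 * e}. ?g j)" by simp
  moreover have "(\<Sum>j\<in>{e<..2 * e}. ?g j) \<le> (8/9) ^ e"
    using assms by (intro binomial_tail_bound) auto
  moreover have "0 \<le> (\<Sum>j\<in>{e<..2 * e}. ?g j)"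
    using assms by (intro sum_nonneg) auto
  ultimately show ?thesis by simp
qed

lemma rank_one_sum_majority_poly:
  assumes "rank_one_sum K F" "rank_one_sum K G"
  shows "\<exists>L\<le>4 ^ e * K ^ (2 * e). rank_one_sum L (\<lambda>x y. majority_poly e (F x y) (G x y))"
proof -
  let ?L = "\<Sum>j = e..2 * e. (2 * e choose j) * (K ^ j * K ^ (2 * e - j))"
  have "?L = (\<Sum>j = e..2 * e. (2 * e choose j) * K ^ (2 * e))"
    by (intro sum.cong refl) (simp flip: power_add)
  also have "\<dots> \<le> (\<Sum>j\<le>2 * e. (2 * e choose j) * K ^ (2 * e))"
    by (intro sum_mono2) auto
  also have "\<dots> = 4 ^ e * K ^ (2 * e)"
    using choose_row_sum[of "2 * e"] by (simp add: power_mult flip: sum_distrib_right)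
  finally have "?L \<le> 4 ^ e * K ^ (2 * e)" .
  moreover have "rank_one_sum ?L (\<lambda>x y. majority_poly e (F x y) (G x y))"
    unfolding majority_poly_def
    by (intro rank_one_sum_sum rank_one_sum_of_nat_mult rank_one_sum_mult rank_one_sum_power assms) simp
  ultimately show ?thesis by blast
qed

lemma of_real_majority_poly:
  "complex_of_real (majority_poly e p q) = majority_poly e (of_real p) (of_real q)"
  by (simp add: majority_poly_def)

text \<open>The choice of \<open>L\<close> makes the pointwise error \<open>1 / 2 ^ L\<close> at
  most half the density of the popular size \<open>k\<close>. The amplified probability therefore
  has correlation at least \<open>4 ^ card S / 2 ^ L\<close>, while its number \<open>R\<close> of
  terms allows at most \<open>R * sqrt (8 ^ card S)\<close>. Squaring and cancelling
  \<open>8 ^ card S\<close> leaves \<open>2 ^ card S\<close>.\<close>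

lemma intersection_size_rank_bound:
  fixes f g :: "'a set \<Rightarrow> 'a set \<Rightarrow> real"
  assumes "finite S"
    and rank: "rank_one_sum K (\<lambda>X Y. complex_of_real (f X Y))" "rank_one_sum K (\<lambda>X Y. complex_of_real (g X Y))"
    and f: "\<And>X Y. 0 \<le> f X Y" and g: "\<And>X Y. 0 \<le> g X Y" and fg: "\<And>X Y. f X Y + g X Y = 1"
    and big: "\<And>X Y. X \<subseteq> S \<Longrightarrow> Y \<subseteq> S \<Longrightarrow> card (X \<inter> Y) = k \<Longrightarrow> g X Y \<le> 1/3"
    and small: "\<And>X Y. X \<subseteq> S \<Longrightarrow> Y \<subseteq> S \<Longrightarrow> card (X \<inter> Y) \<noteq> k \<Longrightarrow> f X Y \<le> 1/3"
    and k: "4 ^ card S \<le> (card S + 1) * card {(X, Y) \<in> Pow S \<times> Pow S. card (X \<inter> Y) = k}"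
    and L: "2 * (card S + 1) \<le> 2 ^ L"
  shows "2 ^ card S \<le> (2 ^ L * (4 ^ (6 * L) * K ^ (12 * L))) ^ 2"
proof -
  let ?m = "card S" and ?e = "6 * L"
  let ?N = "card {(X, Y) \<in> Pow S \<times> Pow S. card (X \<inter> Y) = k}"
  obtain R where R: "R \<le> 4 ^ ?e * K ^ (2 * ?e)"
    and rankR: "rank_one_sum R (\<lambda>X Y. majority_poly ?e (complex_of_real (f X Y)) (complex_of_real (g X Y)))"
    using rank_one_sum_majority_poly[OF rank] by blast
  \<comment> \<open>Six is the exponent at which \<open>8/9\<close> drops below \<open>1/2\<close>,
    hence the choice \<open>6 * L\<close>.\<close>
  have "((8/9) ^ 6 :: real) ^ L \<le> (1/2) ^ L"
    by (intro power_mono) (auto simp: power_divide)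
  then have eps: "(8/9 :: real) ^ ?e \<le> 1 / 2 ^ L"
    by (simp add: power_mult power_one_over)
  have "cmod (majority_poly ?e (complex_of_real (f X Y)) (complex_of_real (g X Y))
      - of_bool (card (X \<inter> Y) = k)) \<le> 1 / 2 ^ L" if XY: "X \<subseteq> S" "Y \<subseteq> S" for X Y
  proof (cases "card (X \<inter> Y) = k")
    case True
    have "cmod (majority_poly ?e (complex_of_real (f X Y)) (complex_of_real (g X Y)) - 1)
        = \<bar>majority_poly ?e (f X Y) (g X Y) - 1\<bar>"
      unfolding of_real_majority_poly[symmetric] by (metis norm_of_real of_real_1 of_real_diff)
    then show ?thesis
      using True majority_poly_large[OF g big[OF XY True] fg, of ?e] eps by simp
  next
    case False
    have "cmod (majority_poly ?e (complex_of_real (f X Y)) (complex_of_real (g X Y)))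
        = \<bar>majority_poly ?e (f X Y) (g X Y)\<bar>"
      unfolding of_real_majority_poly[symmetric] by (rule norm_of_real)
    then show ?thesis
      using False majority_poly_small[OF f small[OF XY False] fg, of ?e] eps by simp
  qed
  from intersection_correlation_ge[OF assms(1) this]
  have "real ?N - 1 / 2 ^ L * 4 ^ ?m \<le> real R * sqrt (8 ^ ?m)"
    using rank_one_sum_hadamard_correlation[OF rankR assms(1)] by linarith
  then have "real ?N * 2 ^ L \<le> 2 ^ L * (real R * sqrt (8 ^ ?m)) + 4 ^ ?m"
    by (simp add: field_simps)
  moreover have "2 * 4 ^ ?m \<le> real ?N * 2 ^ L"
  proof -
    have "2 * 4 ^ ?m \<le> 2 * ((?m + 1) * ?N)" using k by simp
    also have "\<dots> \<le> 2 ^ L * ?N" using mult_right_mono[OF L, of ?N] by simp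
    finally have "real (2 * 4 ^ ?m) \<le> real (2 ^ L * ?N)" by (rule of_nat_mono)
    then show ?thesis by (simp add: mult.commute)
  qed
  ultimately have "4 ^ ?m \<le> 2 ^ L * (real R * sqrt (8 ^ ?m))" by simp
  then have "(4 ^ ?m)\<^sup>2 \<le> (2 ^ L * (real R * sqrt (8 ^ ?m)))\<^sup>2"
    by (rule power_mono) simp
  then have "16 ^ ?m \<le> (2 ^ L * real R)\<^sup>2 * 8 ^ ?m"
    by (simp add: power_mult_distrib flip: power_mult) (simp add: power_mult mult.commute[of ?m])
  moreover have "(16 :: real) ^ ?m = 2 ^ ?m * 8 ^ ?m"
    by (simp flip: power_mult_distrib)
  ultimately have "2 ^ ?m \<le> (2 ^ L * real R)\<^sup>2" by simp
  then have "real (2 ^ ?m) \<le> real ((2 ^ L * R)\<^sup>2)" by simp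
  then have "2 ^ ?m \<le> (2 ^ L * R)\<^sup>2" by (simp only: of_nat_le_iff)
  also have "\<dots> \<le> (2 ^ L * (4 ^ (6 * L) * K ^ (12 * L)))\<^sup>2"
    using R by (intro power_mono mult_left_mono) auto
  finally show ?thesis .
qed

section \<open>Separated rows\<close>

text \<open>Real and imaginary parts of each \<open>a x\<close> are rounded to a grid of width
  \<open>1 / D\<close>, and the cell lists the rounded pairs. Equal cells cost at most
  \<open>2 / D\<close> per term because \<open>b\<close> is bounded by 1.\<close>

lemma rank_one_sum_quantize:
  fixes D :: nat
  assumes "rank_one_sum K F" "0 < D"
  shows "\<exists>cell. (\<forall>x. length (cell x) = K \<and> set (cell x) \<subseteq> {- int D..int D} \<times> {- int D..int D}) \<and>
    (\<forall>x x' y. cell x = cell x' \<longrightarrow> cmod (F x y - F x' y) \<le> real K * (2 / real D))"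
  using assms(1)
proof induction
  case zero
  show ?case by (intro exI[of _ "\<lambda>_. []"]) simp
next
  case (step K F a b)
  then obtain cell where cell: "\<And>x. length (cell x) = K"
      "\<And>x. set (cell x) \<subseteq> {- int D..int D} \<times> {- int D..int D}"
    and close: "\<And>x x' y. cell x = cell x' \<Longrightarrow> cmod (F x y - F x' y) \<le> real K * (2 / real D)"
    by blast
  define grid where "grid x = (\<lfloor>real D * Re (a x)\<rfloor>, \<lfloor>real D * Im (a x)\<rfloor>)" for x
  have bound: "\<lfloor>real D * r\<rfloor> \<in> {- int D..int D}" if "\<bar>r\<bar> \<le> 1" for r
  proof -
    have "\<bar>real D * r\<bar> \<le> real D" using that by (simp add: abs_mult mult_left_le)
    then show ?thesis by (auto simp: le_floor_iff floor_le_iff abs_le_iff)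
  qed
  have "\<bar>Re (a x)\<bar> \<le> 1" "\<bar>Im (a x)\<bar> \<le> 1" for x
    using abs_Re_le_cmod[of "a x"] abs_Im_le_cmod[of "a x"] step.hyps(2)[of x] by linarith+
  then have grid: "grid x \<in> {- int D..int D} \<times> {- int D..int D}" for x
    using bound by (simp add: grid_def del: atLeastAtMost_iff)
  have near: "\<bar>r - s\<bar> \<le> 1 / real D" if "\<lfloor>real D * r\<rfloor> = \<lfloor>real D * s\<rfloor>" for r s
  proof -
    have "\<bar>real D * r - real D * s\<bar> \<le> 1"
      using that by linarith
    then have "real D * \<bar>r - s\<bar> \<le> 1"
      by (simp add: abs_mult flip: right_diff_distrib)
    then show ?thesis using assms(2) by (simp add: field_simps)
  qed
  have "cmod (F x y + a x * b y - (F x' y + a x' * b y)) \<le> real (Suc K) * (2 / real D)"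
    if "grid x # cell x = grid x' # cell x'" for x x' y
  proof -
    have "cmod (a x - a x') \<le> \<bar>Re (a x) - Re (a x')\<bar> + \<bar>Im (a x) - Im (a x')\<bar>"
      using cmod_le[of "a x - a x'"] by simp
    also have "\<dots> \<le> 2 / real D"
      using that near[of "Re (a x)" "Re (a x')"] near[of "Im (a x)" "Im (a x')"] by (simp add: grid_def)
    finally have "cmod ((a x - a x') * b y) \<le> 2 / real D"
      using mult_left_le[OF step.hyps(3), of "cmod (a x - a x')" y] by (simp add: norm_mult)
    moreover have "F x y + a x * b y - (F x' y + a x' * b y) = (F x y - F x' y) + (a x - a x') * b y"
      by (simp add: algebra_simps)
    ultimately show ?thesis
      using norm_triangle_ineq[of "F x y - F x' y" "(a x - a x') * b y"] close[of x x' y] that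
      by (simp add: algebra_simps add_divide_distrib)
  qed
  then show ?case
    using cell grid by (intro exI[of _ "\<lambda>x. grid x # cell x"]) auto
qed

text \<open>Separated rows must lie in different cells, so their number is at most the number of
  lists of \<open>K\<close> grid points.\<close>

lemma rank_one_sum_distinct_rows:
  assumes "rank_one_sum K F" "0 < K"
    and sep: "\<And>x x'. x \<in> X \<Longrightarrow> x' \<in> X \<Longrightarrow> x \<noteq> x' \<Longrightarrow> \<exists>y. 1/3 \<le> cmod (F x y - F x' y)"
  shows "card X \<le> (14 * K + 1) ^ (2 * K)"
proof -
  let ?G = "{- int (7 * K)..int (7 * K)} \<times> {- int (7 * K)..int (7 * K)}"
  obtain cell where cell: "\<And>x. length (cell x) = K" "\<And>x. set (cell x) \<subseteq> ?G"
    and close: "\<And>x x' y. cell x = cell x' \<Longrightarrow> cmod (F x y - F x' y) \<le> real K * (2 / real (7 * K))"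
    using rank_one_sum_quantize[OF assms(1), of "7 * K"] assms(2) by (metis mult_pos_pos zero_less_numeral)
  \<comment> \<open>The grid parameter \<open>7 * K\<close> makes rows of one cell
    \<open>2/7\<close>-close, just below the separation \<open>1/3\<close>.\<close>
  have "real K * (2 / real (7 * K)) < 1/3" using assms(2) by simp
  then have "inj_on cell X"
    unfolding inj_on_def using sep close by (meson dual_order.strict_trans2 not_less)
  then have "card X \<le> card {xs. set xs \<subseteq> ?G \<and> length xs = K}"
    using cell by (intro card_inj_on_le) (auto intro: finite_lists_length_eq)
  also have "\<dots> = (card ?G) ^ K" by (rule card_lists_length_eq) simp
  also have "card ?G = (14 * K + 1)\<^sup>2"
    by (simp add: card_cartesian_product power2_eq_square nat_add_distrib nat_mult_distrib)
  finally show ?thesis by (simp add: power_mult)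
qed

section \<open>Problems embedded in HAM\<close>

definition bits :: "nat \<Rightarrow> nat set \<Rightarrow> bool list" where
  "bits n A = map (\<lambda>i. i \<in> A) [0..<n]"

lemma length_bits [simp]: "length (bits n A) = n"
  by (simp add: bits_def)

lemma nth_bits [simp]: "i < n \<Longrightarrow> bits n A ! i \<longleftrightarrow> i \<in> A"
  by (simp add: bits_def)

lemma HAM_bits: "HAM t n (bits n A) (bits n B) \<longleftrightarrow> card {i. i < n \<and> (i \<in> A) \<noteq> (i \<in> B)} \<noteq> t"
  unfolding HAM_def by (intro arg_cong[of _ _ "\<lambda>S. card S \<noteq> t"]) auto

text \<open>The last \<open>t\<close> coordinates always differ and use up the whole allowance; any
  difference among the others raises the distance above \<open>t\<close>.\<close>

lemma HAM_inequality_embedding: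
  assumes "t \<le> n" "X \<subseteq> {..<n - t}" "Y \<subseteq> {..<n - t}"
  shows "HAM t n (bits n X) (bits n (Y \<union> {n - t..<n})) \<longleftrightarrow> X \<noteq> Y"
proof -
  let ?D = "(X - Y) \<union> (Y - X)"
  have fin: "finite X" "finite Y" using assms finite_subset by blast+
  have "{i. i < n \<and> (i \<in> X) \<noteq> (i \<in> Y \<union> {n - t..<n})} = ?D \<union> {n - t..<n}"
    using assms by auto
  moreover have "card (?D \<union> {n - t..<n}) = card ?D + t"
    using assms fin by (subst card_Un_disjoint) auto
  moreover have "card ?D = 0 \<longleftrightarrow> X = Y" using fin by auto
  ultimately show ?thesis by (simp add: HAM_bits)
qed

lemma mem_shift_image: "i \<in> (+) a ` Z \<longleftrightarrow> a \<le> i \<and> i - a \<in> Z" for i a :: nat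
  by (auto simp: image_iff intro!: bexI[of _ "i - a"])

text \<open>For bits \<open>a\<close>, \<open>b\<close> the three-bit strings \<open>(a, \<not> a, 0)\<close> and \<open>(b, 0, \<not> b)\<close> have
  Hamming distance \<open>2 - 2ab\<close>.\<close>

lemma HAM_intersection_embedding:
  assumes "3 * m \<le> t" "2 * t \<le> n" "k \<le> m" "X \<subseteq> {..<m}" "Y \<subseteq> {..<m}"
  shows "HAM t n (bits n (X \<union> (+) m ` ({..<m} - X)))
      (bits n (Y \<union> (+) (2 * m) ` ({..<m} - Y) \<union> {3 * m..<m + t + 2 * k}))
    \<longleftrightarrow> card (X \<inter> Y) \<noteq> k"
proof -
  let ?A = "X \<union> (+) m ` ({..<m} - X)"
  \<comment> \<open>The final interval adds \<open>t + 2 * k - 2 * m\<close> differences to the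
    \<open>2 * m - 2 * card (X \<inter> Y)\<close> of the blocks, so the distance is
    \<open>t\<close> exactly when the intersection has size \<open>k\<close>. It fits below
    \<open>n\<close> because \<open>m + t + 2 * k \<le> 2 * t \<le> n\<close>.\<close>
  let ?B = "Y \<union> (+) (2 * m) ` ({..<m} - Y) \<union> {3 * m..<m + t + 2 * k}"
  let ?D = "(X - Y) \<union> (Y - X)"
  have fin: "finite X" "finite Y" using assms finite_subset by blast+
  have le: "card X \<le> m" "card Y \<le> m"
    using card_mono[OF _ assms(4)] card_mono[OF _ assms(5)] by auto
  have XY: "i < m" if "i \<in> X \<or> i \<in> Y" for i using assms(4,5) that by auto
  have eq: "{i. i < n \<and> (i \<in> ?A) \<noteq> (i \<in> ?B)}
      = ?D \<union> ((+) m ` ({..<m} - X) \<union> ((+) (2 * m) ` ({..<m} - Y) \<union> {3 * m..<m + t + 2 * k}))"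
    (is "?l = ?r")
  proof (rule set_eqI)
    fix i
    consider "i < m" | "m \<le> i" "i < 2 * m" | "2 * m \<le> i" "i < 3 * m" | "3 * m \<le> i" by linarith
    then show "i \<in> ?l \<longleftrightarrow> i \<in> ?r"
      using assms(1-3) XY[of i] by cases (auto simp: mem_shift_image)
  qed
  let ?U = "(+) m ` ({..<m} - X)" and ?V = "(+) (2 * m) ` ({..<m} - Y)" and ?W = "{3 * m..<m + t + 2 * k}"
  have "card ?r = card ?D + card (?U \<union> (?V \<union> ?W))"
  proof (rule card_Un_disjoint)
    show "?D \<inter> (?U \<union> (?V \<union> ?W)) = {}"
      using XY by (fastforce simp: mem_shift_image simp del: image_Un)
  qed (use fin in auto)
  also have "card (?U \<union> (?V \<union> ?W)) = card ?U + card (?V \<union> ?W)"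
    by (rule card_Un_disjoint) auto
  also have "card (?V \<union> ?W) = card ?V + card ?W"
    by (rule card_Un_disjoint) auto
  finally have "card ?r = card ?D + (card ?U + (card ?V + card ?W))" .
  also have "\<dots> = card ?D + ((m - card X) + ((m - card Y) + (t + 2 * k - 2 * m)))"
    using assms(4,5) by (simp add: card_image card_Diff_subset fin)
  finally have card: "card ?r = card ?D + ((m - card X) + ((m - card Y) + (t + 2 * k - 2 * m)))" .
  have "card ?D = card (X - Y) + card (Y - X)"
    using fin by (subst card_Un_disjoint) auto
  moreover have "card X = card (X - Y) + card (X \<inter> Y)" "card Y = card (Y - X) + card (X \<inter> Y)"
    using fin by (auto simp: card_Diff_subset_Int Int_commute card_mono)
  ultimately have "card ?r + 2 * card (X \<inter> Y) = t + 2 * k"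
    using card le assms(1) by linarith
  then show ?thesis unfolding HAM_bits eq by linarith
qed

text \<open>The popular size \<open>k\<close> has to be fixed first, since the padding of Bob's
  string depends on it. The rank bound then applies with \<open>K = 4 ^ c\<close>, where
  \<open>c\<close> is the number of rounds, and comparing exponents of 2 gives the claim.\<close>

lemma computes_intersection_bound:
  assumes P: "computes n (HAM t n) P" and "2 * t \<le> n" "3 * m \<le> t" and L: "2 * (m + 1) \<le> 2 ^ L"
  shows "m \<le> 48 * (L * (length (rounds P) + 1))"
proof -
  let ?S = "{..<m}" and ?c = "length (rounds P)"
  obtain k where k: "k \<le> m" "4 ^ m \<le> (m + 1) * card {(X, Y) \<in> Pow ?S \<times> Pow ?S. card (X \<inter> Y) = k}"
    using popular_intersection_size[of ?S] by auto
  define u where "u X = bits n (X \<union> (+) m ` ({..<m} - X))" for X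
  define v where "v Y = bits n (Y \<union> (+) (2 * m) ` ({..<m} - Y) \<union> {3 * m..<m + t + 2 * k})" for Y
  define pr where "pr b X Y = prob_outcome (nqubits P) (final_state n P (u X) (v Y)) (outq P) b" for b X Y
  have wf: "well_formed n P" using P by (simp add: computes_def)
  have err: "pr (\<not> HAM t n (u X) (v Y)) X Y \<le> 1/3" for X Y
    using P by (simp add: computes_def pr_def u_def v_def)
  have HAM: "HAM t n (u X) (v Y) \<longleftrightarrow> card (X \<inter> Y) \<noteq> k" if "X \<subseteq> ?S" "Y \<subseteq> ?S" for X Y
    unfolding u_def v_def using HAM_intersection_embedding[OF assms(3,2) k(1) that] .
  have nonneg: "0 \<le> pr b X Y" for b X Y
    unfolding pr_def prob_outcome_def by (intro sum_nonneg) simp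
  have "(2::nat) ^ card ?S \<le> (2 ^ L * (4 ^ (6 * L) * (4 ^ ?c) ^ (12 * L))) ^ 2"
  \<comment> \<open>Intersection size \<open>k\<close> means distance \<open>t\<close>, where
    \<open>HAM\<close> is false; so the probability of outcome \<open>False\<close> approximates the
    indicator.\<close>
  proof (rule intersection_size_rank_bound[where f = "pr False" and g = "pr True" and k = k])
    show "rank_one_sum (4 ^ ?c) (\<lambda>X Y. complex_of_real (pr False X Y))"
      "rank_one_sum (4 ^ ?c) (\<lambda>X Y. complex_of_real (pr True X Y))"
      unfolding pr_def by (rule rank_one_sum_compose[OF rank_one_sum_prob_outcome[OF wf]])+
    show "pr False X Y + pr True X Y = 1" for X Y
      using prob_outcome_final_total[OF wf] by (simp add: pr_def add.commute)
    show "pr True X Y \<le> 1/3" if "X \<subseteq> ?S" "Y \<subseteq> ?S" "card (X \<inter> Y) = k" for X Y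
      using err[of X Y] HAM[OF that(1,2)] that(3) by simp
    show "pr False X Y \<le> 1/3" if "X \<subseteq> ?S" "Y \<subseteq> ?S" "card (X \<inter> Y) \<noteq> k" for X Y
      using err[of X Y] HAM[OF that(1,2)] that(3) by simp
  qed (use nonneg k L in simp_all)
  also have "2 ^ L * (4 ^ (6 * L) * (4 ^ ?c) ^ (12 * L)) = (2::nat) ^ (L + (2 * (6 * L) + 2 * (?c * (12 * L))))"
  proof -
    have "(4::nat) ^ j = 2 ^ (2 * j)" for j by (simp add: power_mult)
    then show ?thesis by (simp only: power_mult[symmetric] power_add mult.assoc)
  qed
  finally have "(2::nat) ^ m \<le> 2 ^ ((L + (2 * (6 * L) + 2 * (?c * (12 * L)))) * 2)"
    by (simp only: power_mult card_lessThan)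
  then have "m \<le> (L + (2 * (6 * L) + 2 * (?c * (12 * L)))) * 2"
    by (rule power_le_imp_le_exp[rotated]) simp
  also have "\<dots> \<le> 48 * (L * (?c + 1))" by (simp add: algebra_simps)
  finally show ?thesis .
qed

text \<open>The acceptance probabilities of inequality have \<open>2 ^ (n - t)\<close> pairwise
  separated rows, but \<open>4 ^ c\<close> product terms for \<open>c\<close> rounds allow only
  \<open>2 ^ (2 ^ O(c))\<close> of them.\<close>

lemma computes_inequality_bound:
  assumes P: "computes n (HAM t n) P" and "2 * t \<le> n"
  shows "n \<le> 2 ^ (4 + 3 * length (rounds P))"
proof -
  let ?c = "length (rounds P)"
  define M where "M = n - t"
  define v where "v Y = bits n (Y \<union> {n - t..<n})" for Y
  define pr where "pr b X Y = prob_outcome (nqubits P) (final_state n P (bits n X) (v Y)) (outq P) b" for b X Y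
  have wf: "well_formed n P" using P by (simp add: computes_def)
  have err: "pr (\<not> HAM t n (bits n X) (v Y)) X Y \<le> 1/3" for X Y
    using P by (simp add: computes_def pr_def v_def)
  have HAM: "HAM t n (bits n X) (v Y) \<longleftrightarrow> X \<noteq> Y" if "X \<in> Pow {..<M}" "Y \<in> Pow {..<M}" for X Y
    unfolding v_def using assms(2) that by (intro HAM_inequality_embedding) (auto simp: M_def)
  have total: "pr True X Y + pr False X Y = 1" for X Y
    using prob_outcome_final_total[OF wf] by (simp add: pr_def)
  have "card (Pow {..<M}) \<le> (14 * 4 ^ ?c + 1) ^ (2 * 4 ^ ?c)"
  proof (rule rank_one_sum_distinct_rows)
    show "rank_one_sum (4 ^ ?c) (\<lambda>X Y. complex_of_real (pr True X Y))"
      unfolding pr_def by (rule rank_one_sum_compose[OF rank_one_sum_prob_outcome[OF wf]])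
    fix X X' assume X: "X \<in> Pow {..<M}" "X' \<in> Pow {..<M}" "X \<noteq> X'"
    \<comment> \<open>The column \<open>X'\<close> separates the two rows: it demands
      \<open>False\<close> in row \<open>X'\<close> and \<open>True\<close> in row
      \<open>X\<close>.\<close>
    have "pr True X' X' \<le> 1/3" "pr False X X' \<le> 1/3"
      using err[of X' X'] err[of X X'] HAM[OF X(2,2)] HAM[OF X(1,2)] X(3) by simp_all
    then have "1/3 \<le> \<bar>pr True X X' - pr True X' X'\<bar>"
      using total[of X X'] by linarith
    then show "\<exists>Y. 1/3 \<le> cmod (complex_of_real (pr True X Y) - complex_of_real (pr True X' Y))"
      by (metis norm_of_real of_real_diff)
  qed simp
  also have "\<dots> \<le> (2 ^ (4 + 2 * ?c)) ^ (2 * 4 ^ ?c)"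
    by (intro power_mono) (simp_all add: power_add power_mult)
  finally have "(2::nat) ^ M \<le> 2 ^ ((4 + 2 * ?c) * (2 * 4 ^ ?c))"
    by (simp add: card_Pow power_mult)
  then have "M \<le> (4 + 2 * ?c) * (2 * 4 ^ ?c)"
    by (simp only: power_increasing_iff)
  \<comment> \<open>Absorbing \<open>?c + 1\<close> into \<open>2 ^ ?c\<close> only changes the
    constant, as the final bound takes a logarithm.\<close>
  also have "\<dots> \<le> 8 * (2 ^ ?c * 4 ^ ?c)"
  proof -
    have "?c + 1 \<le> 2 ^ ?c" using less_exp[of ?c] by (simp add: Suc_le_eq)
    then have "8 * (?c + 1) * 4 ^ ?c \<le> 8 * 2 ^ ?c * 4 ^ ?c" by (intro mult_right_mono mult_left_mono) simp_all
    then show ?thesis by (simp add: algebra_simps)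
  qed
  also have "\<dots> = 2 ^ (3 + 3 * ?c)"
    by (simp add: power_add power_mult flip: power_mult_distrib)
  finally have "2 * M \<le> 2 ^ (4 + 3 * ?c)" by (simp add: power_add)
  moreover have "n \<le> 2 * M" using assms(2) by (simp add: M_def)
  ultimately show ?thesis by simp
qed

section \<open>The trivial protocol\<close>

lemma apply_op_permutation:
  assumes "finite S" "\<pi> ` Pow S \<subseteq> Pow S" "w \<subseteq> S"
  shows "apply_op S (\<lambda>v u. if v = \<pi> u then 1 else 0) (\<lambda>z. if z = w then 1 else 0)
       = (\<lambda>z. if z = \<pi> w then 1 else 0)"
proof
  fix z
  have "apply_op S (\<lambda>v u. if v = \<pi> u then 1 else 0) (\<lambda>z. if z = w then 1 else 0) z
      = (\<Sum>u\<in>Pow S. if u = w then if z \<inter> S = \<pi> w \<and> z - S = {} then 1 else 0 else 0 :: complex)"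
    unfolding apply_op_def
  proof (intro sum.cong refl)
    fix u assume u: "u \<in> Pow S"
    have "z - S \<union> u = w \<longleftrightarrow> z - S = {} \<and> u = w" using u assms(3) by auto
    then show "(if z \<inter> S = \<pi> u then 1 else 0) * (if z - S \<union> u = w then 1 else 0)
       = (if u = w then if z \<inter> S = \<pi> w \<and> z - S = {} then 1 else 0 else 0 :: complex)"
      by auto
  qed
  also have "\<dots> = (if z \<inter> S = \<pi> w \<and> z - S = {} then 1 else 0)"
    using assms(1,3) by simp
  also have "z \<inter> S = \<pi> w \<and> z - S = {} \<longleftrightarrow> z = \<pi> w"
    using assms(2,3) by (auto simp: image_subset_iff)
  finally show "apply_op S (\<lambda>v u. if v = \<pi> u then 1 else 0) (\<lambda>z. if z = w then 1 else 0) z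
    = (if z = \<pi> w then 1 else 0)" .
qed

lemma unitary_on_permutation:
  assumes "finite S" "\<pi> ` Pow S \<subseteq> Pow S" "inj_on \<pi> (Pow S)"
  shows "unitary_on S (\<lambda>v u. if v = \<pi> u then 1 else 0)"
  unfolding unitary_on_def
proof (intro ballI)
  fix w w' assume w: "w \<in> Pow S" "w' \<in> Pow S"
  have "(\<Sum>v\<in>Pow S. cnj (if v = \<pi> w then 1 else 0) * (if v = \<pi> w' then 1 else 0))
      = (\<Sum>v\<in>Pow S. if v = \<pi> w then if \<pi> w = \<pi> w' then 1 else 0 else 0 :: complex)"
    by (intro sum.cong) auto
  also have "\<dots> = (if \<pi> w = \<pi> w' then 1 else 0)"
    using assms(1,2) w by (simp add: image_subset_iff)
  also have "\<pi> w = \<pi> w' \<longleftrightarrow> w = w'" using assms(3) w by (auto dest: inj_onD)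
  finally show "(\<Sum>v\<in>Pow S. cnj (if v = \<pi> w then 1 else 0) * (if v = \<pi> w' then 1 else 0))
      = (if w = w' then 1 else 0 :: complex)" .
qed

abbreviation id_op :: qop where
  "id_op \<equiv> \<lambda>v u. if v = u then 1 else 0"

lemma apply_op_identity:
  assumes "finite S"
  shows "apply_op S id_op \<psi> = \<psi>"
proof
  fix z
  have "apply_op S id_op \<psi> z
      = (\<Sum>u\<in>Pow S. if u = z \<inter> S then \<psi> (z - S \<union> z \<inter> S) else 0)"
    unfolding apply_op_def by (intro sum.cong) auto
  also have "\<dots> = \<psi> z" using assms by (simp add: Un_commute[of "z - S"] Int_Diff_Un)
  finally show "apply_op S id_op \<psi> z = \<psi> z" .
qed

lemma alice_sends:
  assumes "distinct qs" "\<And>q. q \<in> set qs \<Longrightarrow> q < N \<and> own q = Alice"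
  defines "ss \<equiv> map (\<lambda>q. (Alice, id_op, q)) qs"
    and "own' \<equiv> \<lambda>i. if i \<in> set qs then Bob else own i"
  shows "valid_rounds N own (ss @ rs) \<longleftrightarrow> valid_rounds N own' rs"
    and "run_rounds N own (ss @ rs) \<psi> = run_rounds N own' rs \<psi>"
  using assms(1,2) unfolding ss_def own'_def
proof (induction qs arbitrary: own)
  case Nil
  case 1 show ?case by simp
  case 2 show ?case by simp
next
  case (Cons q qs)
  have fin: "finite (owned N own p)" for own p by (rule finite_subset[OF owned_subset]) simp
  have upd: "(\<lambda>i. if i \<in> set qs then Bob else (own(q := Bob)) i)
      = (\<lambda>i. if i \<in> set (q # qs) then Bob else own i)" for own :: "nat \<Rightarrow> player"
    by auto
  {
    case 1
    have "valid_rounds N (own(q := Bob)) (map (\<lambda>q. (Alice, id_op, q)) qs @ rs)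
        \<longleftrightarrow> valid_rounds N (\<lambda>i. if i \<in> set (q # qs) then Bob else own i) rs"
      unfolding upd[symmetric] using 1 by (intro Cons.IH) auto
    moreover have "q \<in> owned N own Alice" using 1 by (auto simp: owned_def)
    moreover have "unitary_on (owned N own Alice) id_op"
      using unitary_on_permutation[OF fin, of "\<lambda>u. u"] by simp
    ultimately show ?case by (simp del: fun_upd_apply)
  next
    case 2
    have "run_rounds N (own(q := Bob)) (map (\<lambda>q. (Alice, id_op, q)) qs @ rs) \<psi>
        = run_rounds N (\<lambda>i. if i \<in> set (q # qs) then Bob else own i) rs \<psi>"
      unfolding upd[symmetric] using 2 by (intro Cons.IH) auto
    then show ?case by (simp add: apply_op_identity[OF fin] del: fun_upd_apply)
  }
qed

text \<open>Alice sends her whole input; Bob then holds every qubit and flips qubit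
  \<open>2 * n\<close> if \<open>f\<close> is true. The flip does not touch the input qubits, so
  \<open>\<pi>\<close> is an involution on basis states and its matrix is unitary.\<close>

lemma computes_exists: "\<exists>P. computes n f P"
proof -
  define fw where "fw w = f (bits n w) (map (\<lambda>i. n + i \<in> w) [0..<n])" for w
  define flip where "flip w = (if 2 * n \<in> w then w - {2 * n} else insert (2 * n) w)" for w
  define \<pi> where "\<pi> w = (if fw w then flip w else w)" for w
  define ss where "ss = map (\<lambda>q. (Alice, id_op, q)) [0..<n]"
  define U where "U v u = (if v = \<pi> u then 1 else 0 :: complex)" for v u
  \<comment> \<open>Every round must send a qubit, so Bob's round gives the output qubit to Alice;
    the measurement does not depend on its owner.\<close>
  define P where "P = \<lparr>nqubits = 2 * n + 1, alice_ws = {}, rounds = ss @ [(Bob, U, 2 * n)], outq = 2 * n\<rparr>"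
  let ?N = "2 * n + 1"
  let ?own = "\<lambda>i. if i \<in> set [0..<n] then Bob else init_owner n P i"
  have all: "owned ?N ?own Bob = {..<?N}"
    by (auto simp: owned_def init_owner_def P_def)
  have fw_flip: "fw (flip w) = fw w" for w
  proof -
    have "bits n (flip w) = bits n w" "map (\<lambda>i. n + i \<in> flip w) [0..<n] = map (\<lambda>i. n + i \<in> w) [0..<n]"
      by (auto simp: bits_def flip_def)
    then show ?thesis by (simp only: fw_def)
  qed
  have "flip (flip w) = w" for w by (auto simp: flip_def)
  then have "\<pi> (\<pi> w) = w" for w by (simp add: \<pi>_def fw_flip)
  then have inj: "inj_on \<pi> A" for A by (metis inj_onI)
  have maps: "\<pi> ` Pow {..<?N} \<subseteq> Pow {..<?N}"
    by (auto simp: \<pi>_def flip_def split: if_splits)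
  have U: "U = (\<lambda>v u. if v = \<pi> u then 1 else 0)" by (simp add: U_def fun_eq_iff)
  have "unitary_on {..<?N} U"
    unfolding U using maps inj by (intro unitary_on_permutation) auto
  then have "valid_rounds ?N ?own [(Bob, U, 2 * n)]"
    by (simp only: valid_rounds.simps all) simp
  then have "valid_rounds ?N (init_owner n P) (rounds P)"
    using alice_sends(1)[of "[0..<n]" ?N "init_owner n P" "[(Bob, U, 2 * n)]"]
    by (simp add: P_def ss_def init_owner_def)
  then have wf: "well_formed n P" by (simp add: well_formed_def P_def)
  have "prob_outcome (nqubits P) (final_state n P x y) (outq P) (\<not> f x y) \<le> 1/3"
    if xy: "length x = n" "length y = n" for x y
  proof -
    define w where "w = {i. i < n \<and> x ! i} \<union> {n + i | i. i < n \<and> y ! i}"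
    have w: "w \<subseteq> {..<?N}" "2 * n \<notin> w" by (auto simp: w_def)
    have "bits n w = x" "map (\<lambda>i. n + i \<in> w) [0..<n] = y"
      using xy by (auto simp: bits_def w_def intro!: nth_equalityI)
    then have fw: "fw w = f x y" by (simp add: fw_def)
    have "final_state n P x y = run_rounds ?N ?own [(Bob, U, 2 * n)] (init_state n x y)"
      using alice_sends(2)[of "[0..<n]" ?N "init_owner n P" "[(Bob, U, 2 * n)]" "init_state n x y"]
      by (simp add: final_state_def P_def ss_def init_owner_def)
    also have "\<dots> = apply_op {..<?N} U (\<lambda>z. if z = w then 1 else 0)"
      by (simp only: run_rounds.simps all init_state_def w_def)
    also have "\<dots> = (\<lambda>z. if z = \<pi> w then 1 else 0)"
      unfolding U using maps w by (intro apply_op_permutation) auto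
    finally have final: "final_state n P x y = (\<lambda>z. if z = \<pi> w then 1 else 0)" .
    have out: "2 * n \<in> \<pi> w \<longleftrightarrow> f x y"
      using w(2) by (simp add: \<pi>_def flip_def fw)
    have "prob_outcome (nqubits P) (final_state n P x y) (outq P) (\<not> f x y) = 0"
      unfolding prob_outcome_def final using out by (intro sum.neutral) (auto simp: P_def)
    then show ?thesis by simp
  qed
  then show ?thesis using wf unfolding computes_def by blast
qed

section \<open>The lower bound\<close>

text \<open>Without a protocol for \<open>f\<close> the value of \<open>LEAST\<close> would be arbitrary.\<close>

lemma BQC_attained: "\<exists>P. computes n f P \<and> length (rounds P) = BQC n f"
  unfolding BQC_def by (rule LeastI_ex) (use computes_exists in blast)

lemma log_le_BQC:
  assumes "2 * t \<le> n" "0 < n"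
  shows "log 2 (real n) \<le> 4 + 3 * real (BQC n (HAM t n))"
proof -
  obtain P where P: "computes n (HAM t n) P" "length (rounds P) = BQC n (HAM t n)"
    using BQC_attained by blast
  from computes_inequality_bound[OF P(1) assms(1)]
  have "real n \<le> real (2 ^ (4 + 3 * BQC n (HAM t n)))" unfolding P(2) by (rule of_nat_mono)
  then have "log 2 (real n) \<le> log 2 (2 ^ (4 + 3 * BQC n (HAM t n)))"
    using assms(2) by (intro log_mono) (simp_all del: of_nat_le_iff)
  also have "\<dots> = real (4 + 3 * BQC n (HAM t n))" by (rule log_pow_cancel) simp_all
  finally show ?thesis by simp
qed

lemma div_log_le_BQC:
  assumes "2 * t \<le> n"
  shows "real t / log 2 (real t) \<le> 438 * (real (BQC n (HAM t n)) + 1)"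
proof (cases "2 \<le> t")
  case False
  then have "t = 0 \<or> t = 1" by auto
  \<comment> \<open>For \<open>t = 1\<close> the denominator \<open>log 2 1\<close> is 0 and the
    quotient is 0 by the convention for division by zero.\<close>
  then show ?thesis by auto
next
  case True
  obtain P where P: "computes n (HAM t n) P" "length (rounds P) = BQC n (HAM t n)"
    using BQC_attained by blast
  define c where "c = BQC n (HAM t n)"
  define m where "m = t div 3"
  \<comment> \<open>The least exponent that \<open>computes_intersection_bound\<close> admits; it is
    of order \<open>log t\<close>.\<close>
  define L where "L = nat \<lceil>log 2 (real (2 * (m + 1)))\<rceil>"
  have log_t: "1 \<le> log 2 (real t)" using True by (simp add: le_log_iff)
  have "2 * (m + 1) \<le> 2 * t" using True by (simp add: m_def)
  then have "log 2 (real (2 * (m + 1))) \<le> log 2 (2 * real t)"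
    using True by simp
  also have "\<dots> = 1 + log 2 (real t)" using True by (simp add: log_mult)
  finally have "real L \<le> 2 + log 2 (real t)"
    using log_t unfolding L_def by linarith
  then have L_le: "real L \<le> 3 * log 2 (real t)" using log_t by simp
  have "log 2 (real (2 * (m + 1))) \<le> real L"
    unfolding L_def by linarith
  then have "real (2 * (m + 1)) \<le> 2 powr real L"
    by (subst (asm) log_le_iff) simp_all
  then have "real (2 * (m + 1)) \<le> real (2 ^ L)" by (simp add: powr_realpow)
  then have L: "2 * (m + 1) \<le> 2 ^ L" by (simp only: of_nat_le_iff)
  then have "0 < L" by (cases L) auto
  have "m \<le> 48 * (L * (c + 1))"
    using computes_intersection_bound[OF P(1) assms _ L] unfolding P(2) c_def m_def by simp
  moreover have "t \<le> 3 * m + 2" by (simp add: m_def)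
  moreover have "1 \<le> L * (c + 1)" using \<open>0 < L\<close> by simp
  \<comment> \<open>\<open>146 = 3 * 48 + 2\<close>; the remainder of the division by 3 is absorbed
    since \<open>L * (c + 1) \<ge> 1\<close>. With \<open>L \<le> 3 * log t\<close> this gives
    \<open>438 = 3 * 146\<close>.\<close>
  ultimately have "t \<le> 146 * (L * (c + 1))" by linarith
  then have "real t \<le> real (146 * (L * (c + 1)))" by (rule of_nat_mono)
  also have "\<dots> = 146 * (real c + 1) * real L" by (simp add: algebra_simps)
  also have "\<dots> \<le> 146 * (real c + 1) * (3 * log 2 (real t))"
    using L_le by (intro mult_left_mono) auto
  finally show ?thesis
    using log_t by (simp add: divide_le_eq c_def algebra_simps)
qed

theorem theorem5p5:
  fixes t :: "nat \<Rightarrow> nat"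
  assumes "mono t"
    and "\<And>n. real (t n) \<le> real n / 2"
  shows "(\<lambda>n. real (BQC n (HAM (t n) n)))
           \<in> \<Omega>(\<lambda>n. real (t n) / log 2 (real (t n)) + log 2 (real n))"
proof (rule landau_omega.bigI[of "1/890"])
  show "\<forall>\<^sub>F n in sequentially. 1/890 * norm (real (t n) / log 2 (real (t n)) + log 2 (real n))
      \<le> norm (real (BQC n (HAM (t n) n)))"
    using eventually_ge_at_top[of "2 ^ 7"]
  proof eventually_elim
    case (elim n)
    let ?c = "real (BQC n (HAM (t n) n))"
    have "2 * t n \<le> n" using assms(2)[of n] by linarith
    then have log_n: "log 2 (real n) \<le> 4 + 3 * ?c"
      and ratio: "real (t n) / log 2 (real (t n)) \<le> 438 * (?c + 1)"
      using elim log_le_BQC[of "t n" n] div_log_le_BQC[of "t n" n] by simp_all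
    \<comment> \<open>From \<open>n \<ge> 2 ^ 7\<close> on, \<open>7 \<le> 4 + 3 * ?c\<close> forces
      a cost of at least 1, which absorbs the additive constants.\<close>
    have "7 \<le> log 2 (real n)" using elim by (simp add: le_log_iff)
    then have "1 \<le> ?c" using log_n by linarith
    moreover have "0 \<le> real (t n) / log 2 (real (t n))"
      by (cases "t n = 0") simp_all
    \<comment> \<open>The two bounds add up to \<open>442 + 441 * ?c\<close>, at most
      \<open>883 * ?c\<close> and so below \<open>890 * ?c\<close>.\<close>
    ultimately show ?case using log_n ratio \<open>7 \<le> log 2 (real n)\<close> by simp
  qed
qed simp

end
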